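(* Let $D$ be a weighted oriented graph, let $U\subseteq V^+(D)$ be the set of vertices of non-trivial weight which are sinks, and let $D'$ be the weighted oriented graph obtained from $D$ by replacing the weight of each vertex of $U$ by $1$. Let $I=I(D)$ and $\tilde I=I(D')$. Then for each $s\ge1$, $$\operatorname{sdefect}(\tilde I,s)=\operatorname{sdefect}(I,s).$$
   Context: Let $k$ be a field. A weighted oriented graph $D=(V(D),E(D),w)$ has a finite vertex set $V(D)$, a set $E(D)$ of ordered pairs of distinct vertices ($(x,y)\in E(D)$ is a directed edge from $x$ to $y$), each edge $\{x,y\}$ of the underlying simple graph $G$ carrying exactly one orientation, and a weight function $w:V(D)\to\mathbb N=\{1,2,\dots\}$. A vertex is a source (resp. sink) if it has only outgoing (resp. only incoming) edges; convention: sources have weight $1$. $V^+(D)=\{x:w(x)\ne1\}$. The edge ideal of $D$ is $I(D)=(x\,y^{w(y)} : (x,y)\in E(D))$ in the polynomial ring $R$ over $k$ whose variables are the vertices of $D$. For $s\ge1$ the $s$-th symbolic power of an ideal $I$ is $I^{(s)}=\bigcap_{P\in\operatorname{Ass}(I)}(I^sR_P\cap R)$, where $\operatorname{Ass}(I)$ is the set of associated primes of $R/I$. For a monomial ideal $I$, $\mathcal G(I)$ is its set of minimal monomial generators. The symbolic defect $\operatorname{sdefect}(I,s)$ is the number of elements of $\mathcal G(J)$, where $J$ is the ideal that must be added to $I^s$ to obtain $I^{(s)}$, i.e. $I^{(s)}=I^s+J$ with $J$ generated by the monomials in $\mathcal G(I^{(s)})\setminus I^s$; thus $\operatorname{sdefect}(I,s)=|\mathcal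 G(I^{(s)})\setminus I^s|$. *)

theory Defs
  imports "HOL-Algebra.Ideal_Product" "HOL-Algebra.QuotRing" "HOL-Algebra.Divisibility"
    "HOL-Library.Poly_Mapping" "Graph_Theory.Pair_Digraph"
begin

section \<open>Symbolic powers of ideals\<close>

definition loc_rel :: "('a, 'b) ring_scheme \<Rightarrow> 'a set \<Rightarrow> (('a \<times> 'a) \<times> ('a \<times> 'a)) set" where
  "loc_rel R P = {((a, s), (b, t)). a \<in> carrier R \<and> s \<in> carrier R - P \<and>
      b \<in> carrier R \<and> t \<in> carrier R - P \<and>
      (\<exists>u\<in>carrier R - P. u \<otimes>\<^bsub>R\<^esub> (a \<otimes>\<^bsub>R\<^esub> t \<ominus>\<^bsub>R\<^esub> b \<otimes>\<^bsub>R\<^esub> s) = \<zero>\<^bsub>R\<^esub>)}"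

definition loc_frac :: "('a, 'b) ring_scheme \<Rightarrow> 'a set \<Rightarrow> 'a \<Rightarrow> 'a \<Rightarrow> ('a \<times> 'a) set" where
  "loc_frac R P a s = loc_rel R P `` {(a, s)}"

definition localization :: "('a, 'b) ring_scheme \<Rightarrow> 'a set \<Rightarrow> ('a \<times> 'a) set ring" where
  "localization R P =
    \<lparr>carrier = (carrier R \<times> (carrier R - P)) // loc_rel R P,
     monoid.mult = (\<lambda>A B. \<Union>(a, s)\<in>A. \<Union>(b, t)\<in>B. loc_frac R P (a \<otimes>\<^bsub>R\<^esub> b) (s \<otimes>\<^bsub>R\<^esub> t)),
     one = loc_frac R P \<one>\<^bsub>R\<^esub> \<one>\<^bsub>R\<^esub>,
     zero = loc_frac R P \<zero>\<^bsub>R\<^esub> \<one>\<^bsub>R\<^esub>,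
     add = (\<lambda>A B. \<Union>(a, s)\<in>A. \<Union>(b, t)\<in>B.
              loc_frac R P (a \<otimes>\<^bsub>R\<^esub> t \<oplus>\<^bsub>R\<^esub> b \<otimes>\<^bsub>R\<^esub> s) (s \<otimes>\<^bsub>R\<^esub> t))\<rparr>"

context primeideal
begin

lemma one_notin: "\<one> \<notin> I"
  using I_notcarr one_imp_carrier by blast

lemma compl_mult: "s \<in> carrier R - I \<Longrightarrow> t \<in> carrier R - I \<Longrightarrow> s \<otimes> t \<in> carrier R - I"
  using I_prime by auto

lemma loc_rel_iff:
  "((a, s), (b, t)) \<in> loc_rel R I \<longleftrightarrow> a \<in> carrier R \<and> s \<in> carrier R - I \<and>
     b \<in> carrier R \<and> t \<in> carrier R - I \<and> (\<exists>u\<in>carrier R - I. u \<otimes> (a \<otimes> t) = u \<otimes> (b \<otimes> s))"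
proof -
  have "u \<otimes> (a \<otimes> t \<ominus> b \<otimes> s) = \<zero> \<longleftrightarrow> u \<otimes> (a \<otimes> t) = u \<otimes> (b \<otimes> s)"
    if "a \<in> carrier R" "b \<in> carrier R" "s \<in> carrier R" "t \<in> carrier R" "u \<in> carrier R" for u
  proof -
    have "u \<otimes> (a \<otimes> t \<ominus> b \<otimes> s) = u \<otimes> (a \<otimes> t) \<ominus> u \<otimes> (b \<otimes> s)"
      using that by algebra
    moreover have "x \<ominus> y = \<zero> \<longleftrightarrow> x = y" if "x \<in> carrier R" "y \<in> carrier R" for x y
      using that by (metis a_minus_def add.inv_closed minus_equality r_neg)
    ultimately show ?thesis using that by simp
  qed
  then show ?thesis unfolding loc_rel_def by auto
qed

lemma equiv_loc_rel: "equiv (carrier R \<times> (carrier R - I)) (loc_rel R I)"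
proof (rule equivI)
  show "loc_rel R I \<subseteq> (carrier R \<times> (carrier R - I)) \<times> (carrier R \<times> (carrier R - I))"
    by (auto simp: loc_rel_def)
  show "refl_on (carrier R \<times> (carrier R - I)) (loc_rel R I)"
    by (rule refl_onI) (use one_notin in \<open>auto simp: loc_rel_iff\<close>)
  show "sym (loc_rel R I)"
    by (rule symI) (auto simp: loc_rel_iff, metis DiffI)
  show "trans (loc_rel R I)"
  proof (rule transI, clarify)
    fix a s b t c z
    assume 1: "((a, s), (b, t)) \<in> loc_rel R I" and 2: "((b, t), (c, z)) \<in> loc_rel R I"
    from 1 obtain u where u: "u \<in> carrier R - I" "u \<otimes> (a \<otimes> t) = u \<otimes> (b \<otimes> s)"
      by (auto simp: loc_rel_iff)
    from 2 obtain v where v: "v \<in> carrier R - I" "v \<otimes> (b \<otimes> z) = v \<otimes> (c \<otimes> t)"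
      by (auto simp: loc_rel_iff)
    have c: "a \<in> carrier R" "s \<in> carrier R" "b \<in> carrier R" "t \<in> carrier R"
      "c \<in> carrier R" "z \<in> carrier R" "u \<in> carrier R" "v \<in> carrier R"
      using 1 2 u v by (auto simp: loc_rel_iff)
    have "(u \<otimes> v \<otimes> t) \<otimes> (a \<otimes> z) = (v \<otimes> z) \<otimes> (u \<otimes> (a \<otimes> t))" using c by algebra
    also have "\<dots> = (u \<otimes> s) \<otimes> (v \<otimes> (b \<otimes> z))" unfolding u(2) using c by algebra
    also have "\<dots> = (u \<otimes> v \<otimes> t) \<otimes> (c \<otimes> s)" unfolding v(2) using c by algebra
    finally have eq: "(u \<otimes> v \<otimes> t) \<otimes> (a \<otimes> z) = (u \<otimes> v \<otimes> t) \<otimes> (c \<otimes> s)" .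
    have "u \<otimes> v \<otimes> t \<in> carrier R - I"
      using u(1) v(1) 1 by (intro compl_mult) (auto simp: loc_rel_iff)
    with eq 1 2 show "((a, s), (c, z)) \<in> loc_rel R I"
      by (auto simp: loc_rel_iff)
  qed
qed

lemma loc_frac_eq_iff:
  assumes "a \<in> carrier R" "s \<in> carrier R - I" "b \<in> carrier R" "t \<in> carrier R - I"
  shows "loc_frac R I a s = loc_frac R I b t \<longleftrightarrow>
    (\<exists>u\<in>carrier R - I. u \<otimes> (a \<otimes> t) = u \<otimes> (b \<otimes> s))"
  using eq_equiv_class_iff[OF equiv_loc_rel, of "(a,s)" "(b,t)"] assms
  by (auto simp: loc_frac_def loc_rel_iff)

lemma loc_fracI:
  assumes "a \<in> carrier R" "s \<in> carrier R - I" "b \<in> carrier R" "t \<in> carrier R - I"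
    "a \<otimes> t = b \<otimes> s"
  shows "loc_frac R I a s = loc_frac R I b t"
  using assms one_notin by (auto simp: loc_frac_eq_iff)

lemma loc_carrier: "carrier (localization R I) =
    {loc_frac R I a s | a s. a \<in> carrier R \<and> s \<in> carrier R - I}"
  by (auto simp: localization_def loc_frac_def quotient_def)

lemma loc_op:
  assumes "a \<in> carrier R" "s \<in> carrier R - I" "b \<in> carrier R" "t \<in> carrier R - I"
    and "\<And>a s b t a' s' b' t'. ((a, s), (a', s')) \<in> loc_rel R I \<Longrightarrow>
       ((b, t), (b', t')) \<in> loc_rel R I \<Longrightarrow> F a s b t = F a' s' b' t'"
  shows "(\<Union>(a, s)\<in>loc_frac R I a s. \<Union>(b, t)\<in>loc_frac R I b t. F a s b t) = F a s b t"
proof -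
  have self: "((a, s), (a, s)) \<in> loc_rel R I" "((b, t), (b, t)) \<in> loc_rel R I"
    using assms(1-4) one_notin by (auto simp: loc_rel_iff)
  have ne: "loc_frac R I a s \<noteq> {}" "loc_frac R I b t \<noteq> {}"
    using self by (auto simp: loc_frac_def)
  have "F a' s' b' t' = F a s b t"
    if "(a', s') \<in> loc_frac R I a s" "(b', t') \<in> loc_frac R I b t" for a' s' b' t'
    using that by (intro assms(5)[symmetric]) (auto simp: loc_frac_def)
  then show ?thesis
    by (intro SUP_eq_const ne) (auto intro!: SUP_eq_const ne)
qed

lemma loc_mult:
  assumes "a \<in> carrier R" "s \<in> carrier R - I" "b \<in> carrier R" "t \<in> carrier R - I"
  shows "loc_frac R I a s \<otimes>\<^bsub>localization R I\<^esub> loc_frac R I b t = loc_frac R I (a \<otimes> b) (s \<otimes> t)"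
proof -
  have "loc_frac R I (a \<otimes> b) (s \<otimes> t) = loc_frac R I (a' \<otimes> b') (s' \<otimes> t')"
    if 1: "((a, s), (a', s')) \<in> loc_rel R I" and 2: "((b, t), (b', t')) \<in> loc_rel R I"
    for a s b t a' s' b' t'
  proof -
    from 1 obtain u where u: "u \<in> carrier R - I" "u \<otimes> (a \<otimes> s') = u \<otimes> (a' \<otimes> s)"
      by (auto simp: loc_rel_iff)
    from 2 obtain v where v: "v \<in> carrier R - I" "v \<otimes> (b \<otimes> t') = v \<otimes> (b' \<otimes> t)"
      by (auto simp: loc_rel_iff)
    have c: "a \<in> carrier R" "s \<in> carrier R" "b \<in> carrier R" "t \<in> carrier R" "u \<in> carrier R"
      "a' \<in> carrier R" "s' \<in> carrier R" "b' \<in> carrier R" "t' \<in> carrier R" "v \<in> carrier R"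
      using 1 2 u v by (auto simp: loc_rel_iff)
    have "(u \<otimes> v) \<otimes> ((a \<otimes> b) \<otimes> (s' \<otimes> t')) = (u \<otimes> (a \<otimes> s')) \<otimes> (v \<otimes> (b \<otimes> t'))"
      using c by algebra
    also have "\<dots> = (u \<otimes> v) \<otimes> ((a' \<otimes> b') \<otimes> (s \<otimes> t))"
      unfolding u(2) v(2) using c by algebra
    finally show ?thesis
      using c u(1) v(1) 1 2 compl_mult by (subst loc_frac_eq_iff) (auto simp: loc_rel_iff)
  qed
  from loc_op[OF assms this] show ?thesis by (simp add: localization_def)
qed

lemma loc_add:
  assumes "a \<in> carrier R" "s \<in> carrier R - I" "b \<in> carrier R" "t \<in> carrier R - I"
  shows "loc_frac R I a s \<oplus>\<^bsub>localization R I\<^esub> loc_frac R I b t =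
    loc_frac R I (a \<otimes> t \<oplus> b \<otimes> s) (s \<otimes> t)"
proof -
  have "loc_frac R I (a \<otimes> t \<oplus> b \<otimes> s) (s \<otimes> t) = loc_frac R I (a' \<otimes> t' \<oplus> b' \<otimes> s') (s' \<otimes> t')"
    if 1: "((a, s), (a', s')) \<in> loc_rel R I" and 2: "((b, t), (b', t')) \<in> loc_rel R I"
    for a s b t a' s' b' t'
  proof -
    from 1 obtain u where u: "u \<in> carrier R - I" "u \<otimes> (a \<otimes> s') = u \<otimes> (a' \<otimes> s)"
      by (auto simp: loc_rel_iff)
    from 2 obtain v where v: "v \<in> carrier R - I" "v \<otimes> (b \<otimes> t') = v \<otimes> (b' \<otimes> t)"
      by (auto simp: loc_rel_iff)
    have c: "a \<in> carrier R" "s \<in> carrier R" "b \<in> carrier R" "t \<in> carrier R" "u \<in> carrier R"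
      "a' \<in> carrier R" "s' \<in> carrier R" "b' \<in> carrier R" "t' \<in> carrier R" "v \<in> carrier R"
      using 1 2 u v by (auto simp: loc_rel_iff)
    have "(u \<otimes> v) \<otimes> ((a \<otimes> t \<oplus> b \<otimes> s) \<otimes> (s' \<otimes> t')) =
        (v \<otimes> t \<otimes> t') \<otimes> (u \<otimes> (a \<otimes> s')) \<oplus> (u \<otimes> s \<otimes> s') \<otimes> (v \<otimes> (b \<otimes> t'))"
      using c by algebra
    also have "\<dots> = (u \<otimes> v) \<otimes> ((a' \<otimes> t' \<oplus> b' \<otimes> s') \<otimes> (s \<otimes> t))"
      unfolding u(2) v(2) using c by algebra
    finally show ?thesis
      using c u(1) v(1) 1 2 compl_mult by (subst loc_frac_eq_iff) (auto simp: loc_rel_iff)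
  qed
  from loc_op[OF assms this] show ?thesis by (simp add: localization_def)
qed

lemma loc_one: "\<one>\<^bsub>localization R I\<^esub> = loc_frac R I \<one> \<one>"
  and loc_zero: "\<zero>\<^bsub>localization R I\<^esub> = loc_frac R I \<zero> \<one>"
  by (simp_all add: localization_def)

lemma loc_cases:
  assumes "X \<in> carrier (localization R I)"
  obtains a s where "X = loc_frac R I a s" "a \<in> carrier R" "s \<in> carrier R" "s \<notin> I"
  using assms by (auto simp: loc_carrier)

lemma loc_closed: "a \<in> carrier R \<Longrightarrow> s \<in> carrier R \<Longrightarrow> s \<notin> I \<Longrightarrow>
    loc_frac R I a s \<in> carrier (localization R I)"
  by (auto simp: loc_carrier)

lemma cring_localization: "cring (localization R I)"
proof -
  have cm: "\<And>s t. s \<in> carrier R \<Longrightarrow> t \<in> carrier R \<Longrightarrow> s \<notin> I \<Longrightarrow> t \<notin> I \<Longrightarrow> s \<otimes> t \<notin> I"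
    using compl_mult by blast
  note S = loc_mult loc_add loc_one loc_zero loc_closed one_notin cm
  show ?thesis
  proof (rule cringI)
    show "abelian_group (localization R I)"
    proof (rule abelian_groupI)
      fix X assume "X \<in> carrier (localization R I)"
      then obtain a s where X: "X = loc_frac R I a s" "a \<in> carrier R" "s \<in> carrier R" "s \<notin> I"
        by (rule loc_cases)
      have "loc_frac R I (\<ominus> a) s \<oplus>\<^bsub>localization R I\<^esub> X = \<zero>\<^bsub>localization R I\<^esub>"
        unfolding X(1) using X(2-) by (simp add: S, intro loc_fracI) (simp_all add: S, algebra)
      then show "\<exists>Y\<in>carrier (localization R I). Y \<oplus>\<^bsub>localization R I\<^esub> X = \<zero>\<^bsub>localization R I\<^esub>"
        using X by (intro bexI[of _ "loc_frac R I (\<ominus> a) s"]) (auto simp: S)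
    next
      fix X Y Z
      assume "X \<in> carrier (localization R I)" "Y \<in> carrier (localization R I)" "Z \<in> carrier (localization R I)"
      then show "(X \<oplus>\<^bsub>localization R I\<^esub> Y) \<oplus>\<^bsub>localization R I\<^esub> Z =
        X \<oplus>\<^bsub>localization R I\<^esub> (Y \<oplus>\<^bsub>localization R I\<^esub> Z)"
        by (elim loc_cases) (simp add: S, rule loc_fracI, simp_all add: S, algebra)
    next
      fix X Y
      assume "X \<in> carrier (localization R I)" "Y \<in> carrier (localization R I)"
      then show "X \<oplus>\<^bsub>localization R I\<^esub> Y = Y \<oplus>\<^bsub>localization R I\<^esub> X"
        by (elim loc_cases) (simp add: S, rule loc_fracI, simp_all add: S, algebra)
    qed (auto elim!: loc_cases simp: S)
    show "Group.comm_monoid (localization R I)"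
    proof (rule comm_monoidI)
      fix X Y Z
      assume "X \<in> carrier (localization R I)" "Y \<in> carrier (localization R I)" "Z \<in> carrier (localization R I)"
      then show "(X \<otimes>\<^bsub>localization R I\<^esub> Y) \<otimes>\<^bsub>localization R I\<^esub> Z =
        X \<otimes>\<^bsub>localization R I\<^esub> (Y \<otimes>\<^bsub>localization R I\<^esub> Z)"
        by (elim loc_cases) (simp add: S m_assoc)
    next
      fix X Y
      assume "X \<in> carrier (localization R I)" "Y \<in> carrier (localization R I)"
      then show "X \<otimes>\<^bsub>localization R I\<^esub> Y = Y \<otimes>\<^bsub>localization R I\<^esub> X"
        by (elim loc_cases) (simp add: S m_comm)
    qed (auto elim!: loc_cases simp: S)
    fix X Y Z
    assume "X \<in> carrier (localization R I)" "Y \<in> carrier (localization R I)" "Z \<in> carrier (localization R I)"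
    then show "(X \<oplus>\<^bsub>localization R I\<^esub> Y) \<otimes>\<^bsub>localization R I\<^esub> Z =
        X \<otimes>\<^bsub>localization R I\<^esub> Z \<oplus>\<^bsub>localization R I\<^esub> Y \<otimes>\<^bsub>localization R I\<^esub> Z"
      by (elim loc_cases) (simp add: S, rule loc_fracI, simp_all add: S, algebra)
  qed
qed

end

text \<open>The contraction \<open>I R\<^sub>P \<inter> R\<close>: the preimage, under \<open>f \<mapsto> f / 1\<close>, of the ideal of \<open>R\<^sub>P\<close>
  generated by the image of \<open>I\<close>.\<close>

definition loc_contraction :: "('a, 'b) ring_scheme \<Rightarrow> 'a set \<Rightarrow> 'a set \<Rightarrow> 'a set" where
  "loc_contraction R P I = {f \<in> carrier R. loc_frac R P f \<one>\<^bsub>R\<^esub> \<in>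
     genideal (localization R P) ((\<lambda>g. loc_frac R P g \<one>\<^bsub>R\<^esub>) ` I)}"

text \<open>The associated primes of the \<open>R\<close>-module \<open>R / I\<close>: the prime ideals of \<open>R\<close> that are the
  annihilator of some \<open>X\<close> in \<open>R / I\<close>, where \<open>r\<close> acts on \<open>R / I\<close> as multiplication by its class.\<close>

definition associated_primes :: "('a, 'b) ring_scheme \<Rightarrow> 'a set \<Rightarrow> 'a set set" where
  "associated_primes R I = {P. primeideal P R \<and> (\<exists>X\<in>carrier (R Quot I).
     P = {r \<in> carrier R. (I +>\<^bsub>R\<^esub> r) \<otimes>\<^bsub>R Quot I\<^esub> X = \<zero>\<^bsub>R Quot I\<^esub>})}"

definition ideal_power :: "('a, 'b) ring_scheme \<Rightarrow> 'a set \<Rightarrow> nat \<Rightarrow> 'a set" where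
  "ideal_power R I s = I [^]\<^bsub>ideals_set R\<^esub> s"

definition symbolic_power :: "('a, 'b) ring_scheme \<Rightarrow> 'a set \<Rightarrow> nat \<Rightarrow> 'a set" where
  "symbolic_power R I s =
     carrier R \<inter> (\<Inter>P\<in>associated_primes R I. loc_contraction R P (ideal_power R I s))"


section \<open>Monomial ideals and the symbolic defect\<close>

text \<open>The polynomial ring \<open>k[V]\<close>. A polynomial maps exponent vectors to coefficients; it belongs
  to \<open>k[V]\<close> if only variables in \<open>V\<close> occur in it.\<close>

definition mpoly_ring :: "'v set \<Rightarrow> (('v \<Rightarrow>\<^sub>0 nat) \<Rightarrow>\<^sub>0 'k::field) ring" where
  "mpoly_ring V = \<lparr>carrier = {p. \<forall>a\<in>Poly_Mapping.keys p. Poly_Mapping.keys a \<subseteq> V},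
     monoid.mult = (*), one = 1, zero = 0, add = (+)\<rparr>"

lemma cring_mpoly_ring: "cring (mpoly_ring V :: (('v \<Rightarrow>\<^sub>0 nat) \<Rightarrow>\<^sub>0 'k::field) ring)"
  (is "cring ?R")
proof -
  have add: "p + q \<in> carrier ?R" if "p \<in> carrier ?R" "q \<in> carrier ?R" for p q
    using that keys_add[of p q] unfolding mpoly_ring_def by auto
  have mult: "p * q \<in> carrier ?R" if "p \<in> carrier ?R" "q \<in> carrier ?R" for p q
  proof -
    have "x \<in> V" if c: "c \<in> Poly_Mapping.keys (p * q)" and x: "x \<in> Poly_Mapping.keys c" for c x
    proof -
      obtain a b where ab: "a \<in> Poly_Mapping.keys p" "b \<in> Poly_Mapping.keys q" "c = a + b"
        using c keys_mult[of p q] by blast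
      with x keys_add[of a b] have "x \<in> Poly_Mapping.keys a \<union> Poly_Mapping.keys b" by blast
      with ab \<open>p \<in> carrier ?R\<close> \<open>q \<in> carrier ?R\<close> show ?thesis
        unfolding mpoly_ring_def by auto
    qed
    then show ?thesis unfolding mpoly_ring_def by auto
  qed
  have neg: "- p \<in> carrier ?R" if "p \<in> carrier ?R" for p
    using that unfolding mpoly_ring_def by simp
  have one: "1 \<in> carrier ?R" and zero: "0 \<in> carrier ?R"
    unfolding mpoly_ring_def by simp_all
  have ops: "(\<otimes>\<^bsub>?R\<^esub>) = (*)" "(\<oplus>\<^bsub>?R\<^esub>) = (+)" "\<one>\<^bsub>?R\<^esub> = 1" "\<zero>\<^bsub>?R\<^esub> = 0"
    unfolding mpoly_ring_def by simp_all
  show ?thesis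
  proof (rule cringI)
    show "abelian_group ?R"
    proof (rule abelian_groupI)
      fix p assume "p \<in> carrier ?R"
      then show "\<exists>q\<in>carrier ?R. q \<oplus>\<^bsub>?R\<^esub> p = \<zero>\<^bsub>?R\<^esub>"
        unfolding ops by (intro bexI[of _ "- p"]) (simp_all add: neg)
    qed (simp_all only: ops add zero add_0_left add_0_right ac_simps)
    show "Group.comm_monoid ?R"
      by (rule comm_monoidI) (simp_all only: ops mult one mult_1_left mult_1_right ac_simps)
  qed (simp only: ops distrib_right)
qed

definition mvar :: "'v \<Rightarrow> (('v \<Rightarrow>\<^sub>0 nat) \<Rightarrow>\<^sub>0 'k::field)" where
  "mvar x = Poly_Mapping.single (Poly_Mapping.single x 1) 1"

definition monomials :: "'v set \<Rightarrow> (('v \<Rightarrow>\<^sub>0 nat) \<Rightarrow>\<^sub>0 'k::field) set" where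
  "monomials V = {Poly_Mapping.single a 1 | a. Poly_Mapping.keys a \<subseteq> V}"

text \<open>\<open>\<G>(I)\<close>: the monomials of \<open>I\<close> that are minimal with respect to divisibility. By Dickson's
  lemma this set is finite, so \<^const>\<open>card\<close> below is a genuine count.\<close>

definition min_mon_gens ::
    "'v set \<Rightarrow> (('v \<Rightarrow>\<^sub>0 nat) \<Rightarrow>\<^sub>0 'k::field) set \<Rightarrow> (('v \<Rightarrow>\<^sub>0 nat) \<Rightarrow>\<^sub>0 'k) set" where
  "min_mon_gens V I = {m \<in> monomials V \<inter> I.
     \<forall>n \<in> monomials V \<inter> I. n divides\<^bsub>mpoly_ring V\<^esub> m \<longrightarrow> n = m}"

definition sdefect :: "'v set \<Rightarrow> (('v \<Rightarrow>\<^sub>0 nat) \<Rightarrow>\<^sub>0 'k::field) set \<Rightarrow> nat \<Rightarrow> nat" where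
  "sdefect V I s = card (min_mon_gens V (symbolic_power (mpoly_ring V) I s)
                         - ideal_power (mpoly_ring V) I s)"


section \<open>Weighted oriented graphs and their edge ideals\<close>

text \<open>An isolated vertex is both a source and a sink.\<close>

definition source :: "'v pair_pre_digraph \<Rightarrow> 'v \<Rightarrow> bool" where
  "source G x \<longleftrightarrow> x \<in> pverts G \<and> (\<forall>y. (y, x) \<notin> parcs G)"

definition sink :: "'v pair_pre_digraph \<Rightarrow> 'v \<Rightarrow> bool" where
  "sink G x \<longleftrightarrow> x \<in> pverts G \<and> (\<forall>y. (x, y) \<notin> parcs G)"

locale weighted_oriented_graph = pair_digraph G
  for G :: "'v pair_pre_digraph" +
  fixes w :: "'v \<Rightarrow> nat"
  assumes oriented: "(x, y) \<in> parcs G \<Longrightarrow> (y, x) \<notin> parcs G"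
    and weight_pos: "x \<in> pverts G \<Longrightarrow> w x \<ge> 1"
    and weight_source: "source G x \<Longrightarrow> w x = 1"

definition nontrivial_verts :: "'v pair_pre_digraph \<Rightarrow> ('v \<Rightarrow> nat) \<Rightarrow> 'v set" where
  "nontrivial_verts G w = {x \<in> pverts G. w x \<noteq> 1}"

definition edge_ideal ::
    "'v pair_pre_digraph \<Rightarrow> ('v \<Rightarrow> nat) \<Rightarrow> (('v \<Rightarrow>\<^sub>0 nat) \<Rightarrow>\<^sub>0 'k::field) set" where
  "edge_ideal G w = genideal (mpoly_ring (pverts G))
     {mvar x * mvar y ^ w y | x y. (x, y) \<in> parcs G}"

end

theory Submission
  imports Defs
begin

text \<open>Let \<open>\<phi>\<close> be the substitution \<open>x \<mapsto> x\<^bsup>w(x)\<^esup>\<close> for \<open>x \<in> U\<close>, fixing the other variables. A sink occurs in an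
  edge monomial only as a head, so \<open>\<phi>\<close> carries the generators of \<open>I'\<close> to those of \<open>I\<close>. In terms of
  exponents, a monomial lies in \<open>I\<close> iff its coordinatewise quotient by the weights on \<open>U\<close> lies in \<open>I'\<close>.
  This relation passes to ordinary powers. The associated primes of a monomial ideal are the ideals
  \<open>P\<^sub>A\<close> generated by sets \<open>A\<close> of variables with \<open>P\<^sub>A = I : x\<^sup>m\<close> for a monomial \<open>x\<^sup>m\<close>; the sets \<open>A\<close> are the
  same for \<open>I\<close> and \<open>I'\<close>, so the relation passes to symbolic powers as well. Hence \<open>\<phi>\<close> maps
  \<open>\<G>(I'\<^bsup>(s)\<^esup>) - I'\<^sup>s\<close> bijectively onto \<open>\<G>(I\<^bsup>(s)\<^esup>) - I\<^sup>s\<close>.\<close>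

section \<open>Symbolic powers without fractions\<close>

text \<open>Closure under negation is automatic, because the negative of \<open>x\<close> is the
  multiple of \<open>x\<close> by the negative of one; commutativity turns left absorption into
  two-sided absorption.\<close>

lemma (in cring) ideal_criterion:
  assumes sub: "J \<subseteq> carrier R" and ne: "J \<noteq> {}"
    and add: "\<And>x y. x \<in> J \<Longrightarrow> y \<in> J \<Longrightarrow> x \<oplus> y \<in> J"
    and mult: "\<And>x y. x \<in> J \<Longrightarrow> y \<in> carrier R \<Longrightarrow> y \<otimes> x \<in> J"
  shows "ideal J R"
proof (rule idealI)
  show "subgroup J (add_monoid R)"
  proof (rule add.subgroupI)
    fix x assume x: "x \<in> J"
    then have "\<ominus> x = \<ominus> \<one> \<otimes> x" using sub by (simp add: l_minus subset_iff)
    then show "\<ominus> x \<in> J" using mult[OF x] by simp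
  qed (use sub ne add in auto)
  show "x \<otimes> a \<in> J" if "a \<in> J" "x \<in> carrier R" for a x
    using that by (rule mult)
  then show "a \<otimes> x \<in> J" if "a \<in> J" "x \<in> carrier R" for a x
    using that sub m_comm by (metis subsetD)
qed (rule ring_axioms)

text \<open>The contraction is a saturation. The fractions \<open>a / t\<close> with
  \<open>a\<close> in \<open>J\<close> already form an ideal of the localization, so they contain
  the extension of \<open>J\<close>; clearing denominators in \<open>f / 1 = a / t\<close> gives the
  multiplier \<open>u\<close>. Conversely \<open>f / 1\<close> is the product of
  \<open>1 / u\<close> and \<open>(u f) / 1\<close>.\<close>

lemma (in cring) loc_contraction_iff:
  assumes P: "primeideal P R" and J: "ideal J R"
  shows "f \<in> loc_contraction R P J \<longleftrightarrow> f \<in> carrier R \<and> (\<exists>u\<in>carrier R - P. u \<otimes> f \<in> J)"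
proof -
  interpret P: primeideal P R by (rule P)
  interpret J: ideal J R by (rule J)
  let ?L = "localization R P"
  interpret L: cring ?L by (rule P.cring_localization)
  let ?K = "{loc_frac R P a t | a t. a \<in> J \<and> t \<in> carrier R - P}"
  let ?im = "(\<lambda>g. loc_frac R P g \<one>) ` J"
  note cm = P.compl_mult
  have one: "\<one> \<in> carrier R - P" using P.one_notin by simp
  have imc: "?im \<subseteq> carrier ?L"
    using one by (auto intro!: P.loc_closed)
  have K: "ideal ?K ?L"
  proof (rule L.ideal_criterion)
    show "?K \<subseteq> carrier ?L" by (auto intro!: P.loc_closed)
    show "?K \<noteq> {}" using one J.zero_closed by blast
    fix X Y assume "X \<in> ?K"
    then obtain a t where X: "X = loc_frac R P a t" "a \<in> J" "t \<in> carrier R - P" by blast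
    { assume "Y \<in> ?K"
      then obtain b z where Y: "Y = loc_frac R P b z" "b \<in> J" "z \<in> carrier R - P" by blast
      have "X \<oplus>\<^bsub>?L\<^esub> Y = loc_frac R P (a \<otimes> z \<oplus> b \<otimes> t) (t \<otimes> z)"
        unfolding X(1) Y(1) using X Y by (intro P.loc_add) auto
      moreover have "a \<otimes> z \<oplus> b \<otimes> t \<in> J"
        using X Y by (auto intro!: J.a_closed J.I_r_closed)
      ultimately show "X \<oplus>\<^bsub>?L\<^esub> Y \<in> ?K" using cm[OF X(3) Y(3)] by blast }
    { assume "Y \<in> carrier ?L"
      then obtain b z where Y: "Y = loc_frac R P b z" "b \<in> carrier R" "z \<in> carrier R" "z \<notin> P"
        by (rule P.loc_cases)
      have "Y \<otimes>\<^bsub>?L\<^esub> X = loc_frac R P (b \<otimes> a) (z \<otimes> t)"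
        unfolding X(1) Y(1) using X Y by (intro P.loc_mult) auto
      moreover have "b \<otimes> a \<in> J" using X Y by (auto intro!: J.I_l_closed)
      ultimately show "Y \<otimes>\<^bsub>?L\<^esub> X \<in> ?K" using cm[of z t] X Y by blast }
  qed
  show ?thesis
  proof (cases "f \<in> carrier R")
    case f: True
    have "loc_frac R P f \<one> \<in> genideal ?L ?im \<longleftrightarrow> (\<exists>u\<in>carrier R - P. u \<otimes> f \<in> J)"
    proof
      assume "loc_frac R P f \<one> \<in> genideal ?L ?im"
      moreover have "genideal ?L ?im \<subseteq> ?K"
        using K one by (intro L.genideal_minimal) auto
      ultimately obtain a t where at: "loc_frac R P f \<one> = loc_frac R P a t"
        "a \<in> J" "t \<in> carrier R - P" by blast
      then obtain u where u: "u \<in> carrier R - P" "u \<otimes> (f \<otimes> t) = u \<otimes> (a \<otimes> \<one>)"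
        using P.loc_frac_eq_iff[of f \<one> a t] one f by auto
      \<comment> \<open>Equality of fractions holds only up to the factor \<open>u\<close>, so the
        multiplier for \<open>f\<close> is \<open>u t\<close>, which stays outside \<open>P\<close>
        by primality.\<close>
      have "(u \<otimes> t) \<otimes> f = u \<otimes> (f \<otimes> t)" using u at f by (simp add: m_ac)
      also have "\<dots> \<in> J" unfolding u(2) using u at by (auto intro!: J.I_l_closed)
      finally show "\<exists>u\<in>carrier R - P. u \<otimes> f \<in> J" using cm[OF u(1) at(3)] by blast
    next
      assume "\<exists>u\<in>carrier R - P. u \<otimes> f \<in> J"
      then obtain u where u: "u \<in> carrier R - P" "u \<otimes> f \<in> J" by blast
      interpret gen: ideal "genideal ?L ?im" ?L by (rule L.genideal_ideal[OF imc])
      have "loc_frac R P \<one> u \<otimes>\<^bsub>?L\<^esub> loc_frac R P (u \<otimes> f) \<one>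
          = loc_frac R P (\<one> \<otimes> (u \<otimes> f)) (u \<otimes> \<one>)"
        using u f one by (intro P.loc_mult) auto
      also have "\<dots> = loc_frac R P f \<one>"
        using u f one by (intro P.loc_fracI) (auto simp: m_ac)
      finally have "loc_frac R P f \<one>
          = loc_frac R P \<one> u \<otimes>\<^bsub>?L\<^esub> loc_frac R P (u \<otimes> f) \<one>" by simp
      also have "\<dots> \<in> genideal ?L ?im"
        using u one L.genideal_self[OF imc] by (intro gen.I_l_closed) (auto intro!: P.loc_closed)
      finally show "loc_frac R P f \<one> \<in> genideal ?L ?im" .
    qed
    then show ?thesis using f by (simp add: loc_contraction_def)
  qed (simp add: loc_contraction_def)
qed

text \<open>Every class of the quotient has the form \<open>I +> g\<close>, and \<open>r\<close>
  kills it exactly when \<open>r g\<close> lies in \<open>I\<close>. Annihilators of classes are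
  therefore the colon ideals \<open>I : g\<close>.\<close>

lemma (in ideal) associated_primes_iff:
  assumes "cring R"
  shows "P \<in> associated_primes R I \<longleftrightarrow>
    primeideal P R \<and> (\<exists>g\<in>carrier R. P = {r \<in> carrier R. r \<otimes> g \<in> I})"
proof -
  have "(I +> r) \<otimes>\<^bsub>R Quot I\<^esub> (I +> g) = \<zero>\<^bsub>R Quot I\<^esub> \<longleftrightarrow> r \<otimes> g \<in> I"
    if "r \<in> carrier R" "g \<in> carrier R" for r g
  proof -
    have "(I +> r) \<otimes>\<^bsub>R Quot I\<^esub> (I +> g) = I +> (r \<otimes> g)"
      using that by (simp add: FactRing_def rcoset_mult_add)
    moreover have "I +> (r \<otimes> g) = I \<longleftrightarrow> r \<otimes> g \<in> I"
      using that a_rcos_const a_rcos_self[of "r \<otimes> g"] by auto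
    ultimately show ?thesis by (simp add: FactRing_def)
  qed
  then have "{r \<in> carrier R. (I +> r) \<otimes>\<^bsub>R Quot I\<^esub> (I +> g) = \<zero>\<^bsub>R Quot I\<^esub>}
      = {r \<in> carrier R. r \<otimes> g \<in> I}" if "g \<in> carrier R" for g
    using that by blast
  moreover have "carrier (R Quot I) = (\<lambda>g. I +> g) ` carrier R"
    by (auto simp: FactRing_def A_RCOSETS_def')
  ultimately show ?thesis
    unfolding associated_primes_def by auto
qed

lemma (in cring) ideal_ideal_power:
  assumes "ideal I R"
  shows "ideal (ideal_power R I s) R"
proof (induction s)
  case 0
  then show ?case by (simp add: ideal_power_def ideals_set_def oneideal)
next
  case (Suc s)
  then show ?case
    using assms ideal_prod_is_ideal by (simp add: ideal_power_def ideals_set_def nat_pow_def)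
qed

lemma (in cring) symbolic_power_iff:
  assumes "ideal I R"
  shows "f \<in> symbolic_power R I s \<longleftrightarrow> f \<in> carrier R \<and>
    (\<forall>P\<in>associated_primes R I. \<exists>u\<in>carrier R - P. u \<otimes> f \<in> ideal_power R I s)"
proof -
  have "primeideal P R" if "P \<in> associated_primes R I" for P
    using that by (simp add: associated_primes_def)
  then have "f \<in> loc_contraction R P (ideal_power R I s) \<longleftrightarrow>
      f \<in> carrier R \<and> (\<exists>u\<in>carrier R - P. u \<otimes> f \<in> ideal_power R I s)"
    if "P \<in> associated_primes R I" for P
    using that by (intro loc_contraction_iff ideal_ideal_power assms)
  then show ?thesis
    unfolding symbolic_power_def by auto
qed

section \<open>Monomial ideals as sets of exponents\<close>

definition exponents :: "'v set \<Rightarrow> ('v \<Rightarrow>\<^sub>0 nat) set" where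
  "exponents V = {a. Poly_Mapping.keys a \<subseteq> V}"

definition upset :: "'v set \<Rightarrow> ('v \<Rightarrow>\<^sub>0 nat) set \<Rightarrow> bool" where
  "upset V E \<longleftrightarrow> E \<subseteq> exponents V \<and> (\<forall>a\<in>E. \<forall>c\<in>exponents V. a + c \<in> E)"

text \<open>Membership is tested term by term. This is an ideal of \<open>mpoly_ring V\<close> once
  \<open>E\<close> is an upset, and for \<open>E = exponents V\<close> it is the whole ring.\<close>

definition monomial_ideal :: "('v \<Rightarrow>\<^sub>0 nat) set \<Rightarrow> (('v \<Rightarrow>\<^sub>0 nat) \<Rightarrow>\<^sub>0 'k::field) set" where
  "monomial_ideal E = {p. Poly_Mapping.keys p \<subseteq> E}"

definition sumset :: "('v \<Rightarrow>\<^sub>0 nat) set \<Rightarrow> ('v \<Rightarrow>\<^sub>0 nat) set \<Rightarrow> ('v \<Rightarrow>\<^sub>0 nat) set" where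
  "sumset E F = {a + b | a b. a \<in> E \<and> b \<in> F}"

abbreviation mon :: "('v \<Rightarrow>\<^sub>0 nat) \<Rightarrow> (('v \<Rightarrow>\<^sub>0 nat) \<Rightarrow>\<^sub>0 'k::field)" where
  "mon a \<equiv> Poly_Mapping.single a 1"

lemma mpoly_ring_simps [simp]:
  "carrier (mpoly_ring V) = monomial_ideal (exponents V)"
  "(\<otimes>\<^bsub>mpoly_ring V\<^esub>) = (*)" "(\<oplus>\<^bsub>mpoly_ring V\<^esub>) = (+)"
  "\<one>\<^bsub>mpoly_ring V\<^esub> = 1" "\<zero>\<^bsub>mpoly_ring V\<^esub> = 0"
  by (auto simp: mpoly_ring_def monomial_ideal_def exponents_def)

lemma mon_in_monomial_ideal [simp]: "mon a \<in> (monomial_ideal E :: (_ \<Rightarrow>\<^sub>0 'k::field) set) \<longleftrightarrow> a \<in> E"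
  by (simp add: monomial_ideal_def)

lemma mon_mult: "mon a * mon b = (mon (a + b) :: _ \<Rightarrow>\<^sub>0 'k::field)"
  by (simp add: mult_single)

lemma zero_in_exponents [simp]: "0 \<in> exponents V"
  by (simp add: exponents_def)

lemma lookup_eq_0: "a \<in> exponents V \<Longrightarrow> x \<notin> V \<Longrightarrow> Poly_Mapping.lookup a x = 0"
  by (auto simp: exponents_def in_keys_iff)

text \<open>Natural numbers do not cancel in a sum, so the general inclusion \<open>keys_add\<close>
  becomes an equality.\<close>

lemma keys_add_nat: "Poly_Mapping.keys (a + b) = Poly_Mapping.keys a \<union> Poly_Mapping.keys b"
  for a b :: "'v \<Rightarrow>\<^sub>0 nat"
  by (auto simp: in_keys_iff lookup_add)

lemma add_in_exponents [simp]: "a + b \<in> exponents V \<longleftrightarrow> a \<in> exponents V \<and> b \<in> exponents V"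
  by (auto simp: exponents_def keys_add_nat)

lemma upset_exponents: "upset V (exponents V)"
  by (auto simp: upset_def)

lemma upset_sumset_exponents: "B \<subseteq> exponents V \<Longrightarrow> upset V (sumset B (exponents V))"
  unfolding upset_def sumset_def by (fastforce simp: add.assoc)

section \<open>Generation, products and powers of monomial ideals\<close>

lemma ideal_monomial_ideal:
  assumes "upset V E"
  shows "ideal (monomial_ideal E :: (_ \<Rightarrow>\<^sub>0 'k::field) set) (mpoly_ring V)"
proof -
  interpret cring "mpoly_ring V :: (_ \<Rightarrow>\<^sub>0 'k) ring" by (rule cring_mpoly_ring)
  show ?thesis
  proof (rule ideal_criterion)
    show "monomial_ideal E \<subseteq> carrier (mpoly_ring V :: (_ \<Rightarrow>\<^sub>0 'k) ring)"
      using assms by (auto simp: upset_def monomial_ideal_def)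
    show "(monomial_ideal E :: (_ \<Rightarrow>\<^sub>0 'k) set) \<noteq> {}"
      by (auto simp: monomial_ideal_def intro!: exI[of _ 0])
    fix p q :: "_ \<Rightarrow>\<^sub>0 'k" assume p: "p \<in> monomial_ideal E"
    { assume "q \<in> monomial_ideal E"
      with p show "p \<oplus>\<^bsub>mpoly_ring V\<^esub> q \<in> monomial_ideal E"
        using keys_add[of p q] by (auto simp: monomial_ideal_def) }
    { assume q: "q \<in> carrier (mpoly_ring V)"
      have "b + a \<in> E" if "a \<in> Poly_Mapping.keys p" "b \<in> Poly_Mapping.keys q" for a b
      proof -
        have "a \<in> E" "b \<in> exponents V" using that p q by (auto simp: monomial_ideal_def)
        then show ?thesis using assms by (metis add.commute upset_def)
      qed
      then show "q \<otimes>\<^bsub>mpoly_ring V\<^esub> p \<in> monomial_ideal E"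
        using keys_mult[of q p] by (auto simp: monomial_ideal_def) }
  qed
qed

text \<open>A polynomial is the finite sum of its terms, and each term is a constant times a
  monomial of \<open>J\<close>. This reduces the later inclusions of a monomial ideal in another
  ideal to monomials.\<close>

lemma in_ideal_if_monomials:
  assumes J: "ideal J (mpoly_ring V :: (_ \<Rightarrow>\<^sub>0 'k::field) ring)"
    and p: "\<And>a. a \<in> Poly_Mapping.keys p \<Longrightarrow> mon a \<in> J"
  shows "p \<in> J"
proof -
  interpret ideal J "mpoly_ring V :: (_ \<Rightarrow>\<^sub>0 'k) ring" by (rule J)
  have "(\<Sum>a\<in>A. Poly_Mapping.single a (Poly_Mapping.lookup p a)) \<in> J"
    if "finite A" "A \<subseteq> Poly_Mapping.keys p" for A
    using that
  proof (induction A rule: finite_induct)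
    case empty
    then show ?case using additive_subgroup.zero_closed[OF is_additive_subgroup] by simp
  next
    case (insert a A)
    \<comment> \<open>A single term at exponent \<open>0\<close> is a constant polynomial, here the
      coefficient of \<open>a\<close> in \<open>p\<close>.\<close>
    have "Poly_Mapping.single 0 (Poly_Mapping.lookup p a) * mon a \<in> J"
      using insert I_l_closed[of "mon a" "Poly_Mapping.single 0 (Poly_Mapping.lookup p a)"] p
      by (auto simp: monomial_ideal_def)
    then have "Poly_Mapping.single a (Poly_Mapping.lookup p a) \<in> J" by (simp add: mult_single)
    with insert show ?case using additive_subgroup.a_closed[OF is_additive_subgroup] by auto
  qed
  moreover have "p = (\<Sum>a\<in>Poly_Mapping.keys p. Poly_Mapping.single a (Poly_Mapping.lookup p a))"
    by (rule poly_mapping_eqI)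
      (simp add: lookup_sum lookup_single when_def in_keys_iff sum.delta)
  ultimately show ?thesis by (metis finite_keys order_refl)
qed

lemma genideal_monomials:
  assumes B: "B \<subseteq> exponents V"
  shows "genideal (mpoly_ring V) (mon ` B) = (monomial_ideal (sumset B (exponents V)) :: (_ \<Rightarrow>\<^sub>0 'k::field) set)"
    (is "?L = ?R")
proof
  interpret cring "mpoly_ring V :: (_ \<Rightarrow>\<^sub>0 'k) ring" by (rule cring_mpoly_ring)
  have Bc: "mon ` B \<subseteq> carrier (mpoly_ring V :: (_ \<Rightarrow>\<^sub>0 'k) ring)"
    using B by auto
  show "?L \<subseteq> ?R"
    using upset_sumset_exponents[OF B]
    by (intro genideal_minimal ideal_monomial_ideal) (force simp: sumset_def intro: exI[of _ 0])+
  interpret gen: ideal ?L "mpoly_ring V :: (_ \<Rightarrow>\<^sub>0 'k) ring" by (rule genideal_ideal[OF Bc])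
  show "?R \<subseteq> ?L"
  proof
    fix p :: "_ \<Rightarrow>\<^sub>0 'k" assume p: "p \<in> ?R"
    show "p \<in> ?L"
    proof (rule in_ideal_if_monomials[OF gen.is_ideal])
      fix a assume "a \<in> Poly_Mapping.keys p"
      then obtain b c where "a = b + c" "b \<in> B" "c \<in> exponents V"
        using p by (auto simp: monomial_ideal_def sumset_def)
      then show "mon a \<in> ?L"
        using gen.I_r_closed[of "mon b" "mon c"] genideal_self[OF Bc] by (auto simp: mon_mult)
    qed
  qed
qed

lemma upset_sumset: "upset V E \<Longrightarrow> upset V F \<Longrightarrow> upset V (sumset E F)"
  unfolding upset_def sumset_def by (fastforce simp: add.assoc)

lemma ideal_prod_monomial_ideal:
  assumes E: "upset V E" and F: "upset V F"
  shows "ideal_prod (mpoly_ring V) (monomial_ideal E) (monomial_ideal F)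
    = (monomial_ideal (sumset E F) :: (_ \<Rightarrow>\<^sub>0 'k::field) set)" (is "?L = ?R")
proof
  interpret cring "mpoly_ring V :: (_ \<Rightarrow>\<^sub>0 'k) ring" by (rule cring_mpoly_ring)
  show "?L \<subseteq> ?R"
  proof
    fix p :: "_ \<Rightarrow>\<^sub>0 'k" assume "p \<in> ?L"
    then show "p \<in> ?R"
    proof (induction rule: ideal_prod.induct)
      case (prod i j)
      then show ?case
        using keys_mult[of i j] by (fastforce simp: monomial_ideal_def sumset_def)
    next
      case (sum p q)
      then show ?case
        using keys_add[of p q] by (auto simp: monomial_ideal_def)
    qed
  qed
  have ideal: "ideal ?L (mpoly_ring V :: (_ \<Rightarrow>\<^sub>0 'k) ring)"
    by (intro ideal_prod_is_ideal ideal_monomial_ideal E F)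
  show "?R \<subseteq> ?L"
  proof
    fix p :: "_ \<Rightarrow>\<^sub>0 'k" assume p: "p \<in> ?R"
    show "p \<in> ?L"
    proof (rule in_ideal_if_monomials[OF ideal])
      fix a assume "a \<in> Poly_Mapping.keys p"
      then obtain b c where "a = b + c" "b \<in> E" "c \<in> F"
        using p by (auto simp: monomial_ideal_def sumset_def)
      then show "mon a \<in> ?L"
        using ideal_prod.prod[of "mon b" "monomial_ideal E" "mon c" "monomial_ideal F" "mpoly_ring V"]
        by (simp add: mon_mult)
    qed
  qed
qed

text \<open>The base case is all of \<open>exponents V\<close>, not \<open>{0}\<close>, since the
  zeroth power of an ideal is the whole ring.\<close>

fun sumset_power :: "'v set \<Rightarrow> ('v \<Rightarrow>\<^sub>0 nat) set \<Rightarrow> nat \<Rightarrow> ('v \<Rightarrow>\<^sub>0 nat) set" where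
  "sumset_power V E 0 = exponents V"
| "sumset_power V E (Suc s) = sumset (sumset_power V E s) E"

lemma upset_sumset_power: "upset V E \<Longrightarrow> upset V (sumset_power V E s)"
  by (induction s) (simp_all add: upset_exponents upset_sumset)

lemma ideal_power_monomial_ideal:
  assumes "upset V E"
  shows "ideal_power (mpoly_ring V) (monomial_ideal E) s
    = (monomial_ideal (sumset_power V E s) :: (_ \<Rightarrow>\<^sub>0 'k::field) set)"
proof (induction s)
  case 0
  then show ?case by (simp add: ideal_power_def ideals_set_def)
next
  case (Suc s)
  then show ?case
    using ideal_prod_monomial_ideal[OF upset_sumset_power[OF assms] assms]
    by (simp add: ideal_power_def ideals_set_def nat_pow_def)
qed

section \<open>Associated primes of monomial ideals\<close>

text \<open>Take the lexicographically largest elements of \<open>S\<close> and \<open>T\<close>, with respect to any ordering of \<open>W\<close>.\<close>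

lemma exists_unique_sum:
  fixes S T :: "('v \<Rightarrow>\<^sub>0 nat) set"
  assumes "finite W" "finite S" "S \<noteq> {}" "finite T" "T \<noteq> {}"
    and "\<And>a a' x. a \<in> S \<Longrightarrow> a' \<in> S \<Longrightarrow> x \<notin> W \<Longrightarrow> Poly_Mapping.lookup a x = Poly_Mapping.lookup a' x"
    and "\<And>b b' x. b \<in> T \<Longrightarrow> b' \<in> T \<Longrightarrow> x \<notin> W \<Longrightarrow> Poly_Mapping.lookup b x = Poly_Mapping.lookup b' x"
  shows "\<exists>a\<in>S. \<exists>b\<in>T. \<forall>a'\<in>S. \<forall>b'\<in>T. a' + b' = a + b \<longrightarrow> a' = a \<and> b' = b"
  using assms
proof (induction W arbitrary: S T rule: finite_induct)
  case empty
  have "a = a'" if "a \<in> S" "a' \<in> S" for a a'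
    using empty.prems(5)[OF that] by (intro poly_mapping_eqI) simp
  moreover have "b = b'" if "b \<in> T" "b' \<in> T" for b b'
    using empty.prems(6)[OF that] by (intro poly_mapping_eqI) simp
  ultimately show ?case using empty by blast
next
  case (insert x W)
  define M where "M = Max ((\<lambda>a. Poly_Mapping.lookup a x) ` S)"
  define N where "N = Max ((\<lambda>b. Poly_Mapping.lookup b x) ` T)"
  define S' where "S' = {a \<in> S. Poly_Mapping.lookup a x = M}"
  define T' where "T' = {b \<in> T. Poly_Mapping.lookup b x = N}"
  have M: "Poly_Mapping.lookup a x \<le> M" if "a \<in> S" for a
    using that insert.prems unfolding M_def by auto
  have N: "Poly_Mapping.lookup b x \<le> N" if "b \<in> T" for b
    using that insert.prems unfolding N_def by auto
  have "M \<in> (\<lambda>a. Poly_Mapping.lookup a x) ` S"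
    unfolding M_def using insert.prems by (intro Max_in) auto
  then have S': "finite S'" "S' \<noteq> {}" using insert.prems unfolding S'_def by auto
  have "N \<in> (\<lambda>b. Poly_Mapping.lookup b x) ` T"
    unfolding N_def using insert.prems by (intro Max_in) auto
  then have T': "finite T'" "T' \<noteq> {}" using insert.prems unfolding T'_def by auto
  have "\<exists>a\<in>S'. \<exists>b\<in>T'. \<forall>a'\<in>S'. \<forall>b'\<in>T'. a' + b' = a + b \<longrightarrow> a' = a \<and> b' = b"
  proof (rule insert.IH[OF S' T'])
    show "Poly_Mapping.lookup a y = Poly_Mapping.lookup a' y"
      if "a \<in> S'" "a' \<in> S'" "y \<notin> W" for a a' y
      using that insert.prems(5)[of a a' y] unfolding S'_def by (cases "y = x") auto
    show "Poly_Mapping.lookup b y = Poly_Mapping.lookup b' y"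
      if "b \<in> T'" "b' \<in> T'" "y \<notin> W" for b b' y
      using that insert.prems(6)[of b b' y] unfolding T'_def by (cases "y = x") auto
  qed
  then obtain a b where ab: "a \<in> S'" "b \<in> T'"
    "\<And>a' b'. a' \<in> S' \<Longrightarrow> b' \<in> T' \<Longrightarrow> a' + b' = a + b \<Longrightarrow> a' = a \<and> b' = b" by metis
  have "a' = a \<and> b' = b" if "a' \<in> S" "b' \<in> T" "a' + b' = a + b" for a' b'
  proof -
    \<comment> \<open>The coordinates at \<open>x\<close> are at most \<open>M\<close> and
      \<open>N\<close>, so a total of \<open>M + N\<close> forces both to be maximal and puts the
      pair into \<open>S'\<close> and \<open>T'\<close>.\<close>
    have "Poly_Mapping.lookup a' x + Poly_Mapping.lookup b' x = M + N"
      using ab that by (metis (mono_tags, lifting) S'_def T'_def lookup_add mem_Collect_eq)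
    then have "a' \<in> S'" "b' \<in> T'"
      using that M[of a'] N[of b'] unfolding S'_def T'_def by auto
    with ab that show ?thesis by blast
  qed
  with ab show ?case unfolding S'_def T'_def by blast
qed

text \<open>If no other pair of terms has sum \<open>a + b\<close>, nothing can cancel at that
  exponent. When \<open>a\<close> or \<open>b\<close> is not a term, both sides vanish.\<close>

lemma lookup_mult_unique_sum:
  fixes p q :: "('v \<Rightarrow>\<^sub>0 nat) \<Rightarrow>\<^sub>0 'k::field"
  assumes "\<And>a' b'. a' \<in> Poly_Mapping.keys p \<Longrightarrow> b' \<in> Poly_Mapping.keys q \<Longrightarrow> a' + b' = a + b \<Longrightarrow>
    a' = a \<and> b' = b"
  shows "Poly_Mapping.lookup (p * q) (a + b) = Poly_Mapping.lookup p a * Poly_Mapping.lookup q b"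
proof -
  have "Poly_Mapping.lookup p l * (\<Sum>c. Poly_Mapping.lookup q c when a + b = l + c)
      = (Poly_Mapping.lookup p a * Poly_Mapping.lookup q b when l = a)" for l
  proof (cases "l = a")
    case False
    have "Poly_Mapping.lookup p l = 0 \<or> (\<forall>c. (Poly_Mapping.lookup q c when a + b = l + c) = 0)"
      using assms[of l] False by (metis in_keys_iff when_def)
    then show ?thesis using False by auto
  qed simp
  then show ?thesis by (simp add: lookup_mult)
qed

text \<open>Adding \<open>m\<close> is injective on exponents, so multiplication by a monomial
  shifts the terms without merging any.\<close>

lemma keys_mult_mon:
  "Poly_Mapping.keys (p * mon m) = (\<lambda>n. n + m) ` Poly_Mapping.keys p"
  for p :: "('v \<Rightarrow>\<^sub>0 nat) \<Rightarrow>\<^sub>0 'k::field"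
proof
  show "Poly_Mapping.keys (p * mon m) \<subseteq> (\<lambda>n. n + m) ` Poly_Mapping.keys p"
    using keys_mult[of p "mon m"] by auto
  have "Poly_Mapping.lookup (p * mon m) (n + m) = Poly_Mapping.lookup p n" for n
    using lookup_mult_unique_sum[of p "mon m" n m] by simp
  then show "(\<lambda>n. n + m) ` Poly_Mapping.keys p \<subseteq> Poly_Mapping.keys (p * mon m)"
    by (auto simp: in_keys_iff)
qed

lemma mult_mon_in_monomial_ideal:
  "p * mon m \<in> monomial_ideal E \<longleftrightarrow> (\<forall>n\<in>Poly_Mapping.keys p. n + m \<in> E)"
  by (auto simp: monomial_ideal_def keys_mult_mon)

text \<open>The exponents of the monomials in the ideal generated by the variables of
  \<open>V\<close> in \<open>A\<close>.\<close>

definition meeting :: "'v set \<Rightarrow> 'v set \<Rightarrow> ('v \<Rightarrow>\<^sub>0 nat) set" where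
  "meeting V A = {n \<in> exponents V. Poly_Mapping.keys n \<inter> A \<noteq> {}}"

text \<open>If neither factor lies in the ideal, both have terms avoiding \<open>A\<close>. Among
  these choose \<open>a\<close> and \<open>b\<close> whose sum arises in only one way. Any two terms
  with sum \<open>a + b\<close> also avoid \<open>A\<close>, because supports of exponents add up
  without cancellation; so the product has the nonzero term \<open>a + b\<close>, which avoids
  \<open>A\<close> as well.\<close>

lemma primeideal_meeting:
  assumes "finite V"
  shows "primeideal (monomial_ideal (meeting V A) :: (_ \<Rightarrow>\<^sub>0 'k::field) set) (mpoly_ring V)"
proof (rule primeidealI)
  have "upset V (meeting V A)" by (auto simp: upset_def meeting_def keys_add_nat)
  then show "ideal (monomial_ideal (meeting V A) :: (_ \<Rightarrow>\<^sub>0 'k) set) (mpoly_ring V)"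
    by (rule ideal_monomial_ideal)
  show "cring (mpoly_ring V :: (_ \<Rightarrow>\<^sub>0 'k) ring)" by (rule cring_mpoly_ring)
  have "mon 0 \<in> (monomial_ideal (exponents V) :: (_ \<Rightarrow>\<^sub>0 'k) set)"
    "mon 0 \<notin> (monomial_ideal (meeting V A) :: (_ \<Rightarrow>\<^sub>0 'k) set)"
    unfolding mon_in_monomial_ideal by (simp_all add: meeting_def)
  then show "carrier (mpoly_ring V) \<noteq> (monomial_ideal (meeting V A) :: (_ \<Rightarrow>\<^sub>0 'k) set)"
    by auto
  fix p q :: "_ \<Rightarrow>\<^sub>0 'k"
  assume pq: "p \<in> carrier (mpoly_ring V)" "q \<in> carrier (mpoly_ring V)"
    "p \<otimes>\<^bsub>mpoly_ring V\<^esub> q \<in> monomial_ideal (meeting V A)"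
  show "p \<in> monomial_ideal (meeting V A) \<or> q \<in> monomial_ideal (meeting V A)"
  proof (rule ccontr)
    assume neg: "\<not> ?thesis"
    let ?S = "Poly_Mapping.keys p - meeting V A" and ?T = "Poly_Mapping.keys q - meeting V A"
    have V: "Poly_Mapping.keys p \<subseteq> exponents V" "Poly_Mapping.keys q \<subseteq> exponents V"
      using pq by (auto simp: monomial_ideal_def)
    have "\<exists>a\<in>?S. \<exists>b\<in>?T. \<forall>a'\<in>?S. \<forall>b'\<in>?T. a' + b' = a + b \<longrightarrow> a' = a \<and> b' = b"
      using neg V assms
      by (intro exists_unique_sum[of V])
        (auto simp: monomial_ideal_def lookup_eq_0[OF subsetD[OF V(1)]] lookup_eq_0[OF subsetD[OF V(2)]])
    then obtain a b where a: "a \<in> ?S" and b: "b \<in> ?T"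
      and uniq: "\<And>a' b'. a' \<in> ?S \<Longrightarrow> b' \<in> ?T \<Longrightarrow> a' + b' = a + b \<Longrightarrow> a' = a \<and> b' = b"
      by metis
    have ab: "a + b \<notin> meeting V A"
      using a b V by (auto simp: meeting_def keys_add_nat)
    have "a' = a \<and> b' = b"
      if "a' \<in> Poly_Mapping.keys p" "b' \<in> Poly_Mapping.keys q" "a' + b' = a + b" for a' b'
    proof (rule uniq)
      have "a' \<in> exponents V" "b' \<in> exponents V" using that V by auto
      moreover have "a' + b' \<notin> meeting V A" unfolding that(3) by (rule ab)
      ultimately show "a' \<in> ?S" "b' \<in> ?T"
        using that(1,2) by (auto simp: meeting_def keys_add_nat)
    qed (use that in simp)
    then have "Poly_Mapping.lookup (p * q) (a + b)
        = Poly_Mapping.lookup p a * Poly_Mapping.lookup q b"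
      by (rule lookup_mult_unique_sum)
    also have "\<dots> \<noteq> 0" using a b by (auto simp: in_keys_iff)
    finally have "a + b \<in> Poly_Mapping.keys (p * q)" by (simp add: in_keys_iff)
    with pq ab show False by (auto simp: monomial_ideal_def)
  qed
qed

text \<open>The prime ideal generated by the variables in \<open>A\<close> equals \<open>I : x\<^sup>m\<close>, where \<open>I\<close> is the monomial ideal
  with exponent set \<open>E\<close>.\<close>

definition assoc_vars :: "'v set \<Rightarrow> ('v \<Rightarrow>\<^sub>0 nat) set \<Rightarrow> 'v set \<Rightarrow> bool" where
  "assoc_vars V E A \<longleftrightarrow>
    (\<exists>m\<in>exponents V. \<forall>n\<in>exponents V. n + m \<in> E \<longleftrightarrow> Poly_Mapping.keys n \<inter> A \<noteq> {})"

text \<open>The witness \<open>m\<close> makes this prime the annihilator of the class of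
  \<open>mon m\<close>: multiplying by \<open>mon m\<close> shifts each term, and a shifted term
  lies in \<open>E\<close> exactly when the original one meets \<open>A\<close>.\<close>

lemma meeting_in_associated_primes:
  assumes V: "finite V" and E: "upset V E" and A: "assoc_vars V E A"
  shows "(monomial_ideal (meeting V A) :: (_ \<Rightarrow>\<^sub>0 'k::field) set)
    \<in> associated_primes (mpoly_ring V) (monomial_ideal E)"
proof -
  interpret ideal "monomial_ideal E :: (_ \<Rightarrow>\<^sub>0 'k) set" "mpoly_ring V :: (_ \<Rightarrow>\<^sub>0 'k) ring"
    by (rule ideal_monomial_ideal[OF E])
  obtain m where m: "m \<in> exponents V"
    "\<And>n. n \<in> exponents V \<Longrightarrow> n + m \<in> E \<longleftrightarrow> Poly_Mapping.keys n \<inter> A \<noteq> {}"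
    using A by (auto simp: assoc_vars_def)
  have "monomial_ideal (meeting V A)
      = {r \<in> monomial_ideal (exponents V). r * mon m \<in> (monomial_ideal E :: (_ \<Rightarrow>\<^sub>0 'k) set)}"
    using m unfolding mult_mon_in_monomial_ideal
    by (auto simp: monomial_ideal_def meeting_def subset_iff)
  then show ?thesis
    using m(1) primeideal_meeting[OF V, of A, where 'k = 'k]
    unfolding associated_primes_iff[OF cring_mpoly_ring]
    by (intro conjI bexI[of _ "mon m"]) simp_all
qed

lemma exponent_split:
  assumes "x \<in> Poly_Mapping.keys n"
  shows "n = Poly_Mapping.single x 1 + (n - Poly_Mapping.single x (1::nat))"
  using assms by (intro poly_mapping_eqI)
    (auto simp: lookup_add lookup_minus lookup_single when_def in_keys_iff)

text \<open>A monomial is a product of variables, and the complement of a prime is closed under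
  products and contains one. The induction is on the total degree, splitting off one variable at a
  time.\<close>

lemma mon_notin_primeideal:
  assumes V: "finite V" and P: "primeideal P (mpoly_ring V :: (_ \<Rightarrow>\<^sub>0 'k::field) ring)"
    and "n \<in> exponents V" "\<And>x. x \<in> Poly_Mapping.keys n \<Longrightarrow> mon (Poly_Mapping.single x 1) \<notin> P"
  shows "mon n \<notin> P"
  using assms(3,4)
proof (induction "\<Sum>x\<in>V. Poly_Mapping.lookup n x" arbitrary: n rule: less_induct)
  case less
  interpret P: primeideal P "mpoly_ring V :: (_ \<Rightarrow>\<^sub>0 'k) ring" by (rule P)
  show ?case
  proof (cases "n = 0")
    case True
    then show ?thesis using P.one_notin by simp
  next
    case False
    then obtain x where x: "x \<in> Poly_Mapping.keys n" by (metis all_not_in_conv keys_eq_empty)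
    define n' where "n' = n - Poly_Mapping.single x 1"
    have n: "n = Poly_Mapping.single x 1 + n'" unfolding n'_def by (rule exponent_split[OF x])
    have xV: "x \<in> V" using less.prems x by (auto simp: exponents_def)
    have n'V: "n' \<in> exponents V" "Poly_Mapping.single x 1 \<in> exponents V"
      using less.prems n by (metis add_in_exponents)+
    have "(\<Sum>y\<in>V. Poly_Mapping.lookup n y) = 1 + (\<Sum>y\<in>V. Poly_Mapping.lookup n' y)"
      unfolding n using V xV
      by (simp add: lookup_add sum.distrib lookup_single when_def sum.delta)
    moreover have "Poly_Mapping.keys n' \<subseteq> Poly_Mapping.keys n"
      using keys_add_nat[of "Poly_Mapping.single x 1" n'] n by auto
    ultimately have "mon n' \<notin> P"
      using n'V(1) less.prems(2) less.hyps[of n'] by fastforce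
    then show ?thesis
      using P.I_prime[of "mon (Poly_Mapping.single x 1)" "mon n'"] n'V less.prems x
      unfolding mpoly_ring_simps mon_mult n[symmetric] by auto
  qed
qed

text \<open>Write \<open>P = I : g\<close>. The variables in \<open>P\<close> lie in \<open>I : m\<close> for every term \<open>m\<close> of \<open>g\<close>. If every \<open>I : m\<close>
  contained a monomial outside \<open>P\<close>, then the product of these monomials would lie in \<open>I : g\<close> but not
  in the prime \<open>P\<close>; so \<open>I : m\<close> and \<open>P\<close> contain the same monomials for some term \<open>m\<close>.\<close>

lemma associated_primes_monomials:
  fixes P :: "(('v \<Rightarrow>\<^sub>0 nat) \<Rightarrow>\<^sub>0 'k::field) set"
  assumes V: "finite V" and E: "upset V E"
    and P: "P \<in> associated_primes (mpoly_ring V) (monomial_ideal E)"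
  obtains A where "assoc_vars V E A"
    "\<And>n. n \<in> exponents V \<Longrightarrow> mon n \<in> P \<longleftrightarrow> Poly_Mapping.keys n \<inter> A \<noteq> {}"
proof -
  interpret I: ideal "monomial_ideal E :: (_ \<Rightarrow>\<^sub>0 'k) set" "mpoly_ring V :: (_ \<Rightarrow>\<^sub>0 'k) ring"
    by (rule ideal_monomial_ideal[OF E])
  obtain g where prime: "primeideal P (mpoly_ring V)" and g: "g \<in> monomial_ideal (exponents V)"
    and P_eq: "P = {r \<in> monomial_ideal (exponents V). r * g \<in> monomial_ideal E}"
    using P unfolding I.associated_primes_iff[OF cring_mpoly_ring] by auto
  interpret P: primeideal P "mpoly_ring V :: (_ \<Rightarrow>\<^sub>0 'k) ring" by (rule prime)
  define A where "A = {x \<in> V. mon (Poly_Mapping.single x 1) \<in> P}"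
  \<comment> \<open>Multiplying \<open>g\<close> by a monomial only shifts its terms, so each term
    can be tested separately.\<close>
  have mon_P: "mon n \<in> P \<longleftrightarrow> n \<in> exponents V \<and> (\<forall>m\<in>Poly_Mapping.keys g. n + m \<in> E)" for n
    using mult_mon_in_monomial_ideal[of g n E] unfolding P_eq
    by (simp add: mult.commute[of _ g] add.commute)
  have meet: "mon n \<in> P \<longleftrightarrow> Poly_Mapping.keys n \<inter> A \<noteq> {}" if n: "n \<in> exponents V" for n
  proof
    assume "mon n \<in> P"
    then have "\<exists>x\<in>Poly_Mapping.keys n. mon (Poly_Mapping.single x 1) \<in> P"
      using mon_notin_primeideal[OF V prime n] by blast
    then show "Poly_Mapping.keys n \<inter> A \<noteq> {}" using n by (auto simp: A_def exponents_def)
  next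
    assume "Poly_Mapping.keys n \<inter> A \<noteq> {}"
    then obtain x where x: "x \<in> Poly_Mapping.keys n" "mon (Poly_Mapping.single x 1) \<in> P"
      by (auto simp: A_def)
    have "n - Poly_Mapping.single x 1 \<in> exponents V"
      using exponent_split[OF x(1)] n by (metis add_in_exponents)
    then have "mon (Poly_Mapping.single x 1) * mon (n - Poly_Mapping.single x 1) \<in> P"
      using P.I_r_closed[OF x(2), of "mon (n - Poly_Mapping.single x 1)"] by simp
    then show "mon n \<in> P"
      using exponent_split[OF x(1)] by (simp add: mon_mult)
  qed
  have "\<exists>m\<in>Poly_Mapping.keys g. \<forall>n\<in>exponents V. n + m \<in> E \<longrightarrow> Poly_Mapping.keys n \<inter> A \<noteq> {}"
  proof (rule ccontr)
    assume "\<not> ?thesis"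
    then have "\<forall>m\<in>Poly_Mapping.keys g. \<exists>n. n \<in> exponents V \<and> n + m \<in> E \<and> Poly_Mapping.keys n \<inter> A = {}"
      by blast
    then obtain f where f: "\<And>m. m \<in> Poly_Mapping.keys g \<Longrightarrow>
        f m \<in> exponents V \<and> f m + m \<in> E \<and> Poly_Mapping.keys (f m) \<inter> A = {}"
      by metis
    have sumV: "sum f M \<in> exponents V" if "M \<subseteq> Poly_Mapping.keys g" for M
    proof -
      have "Poly_Mapping.keys (sum f M) \<subseteq> (\<Union>m\<in>M. Poly_Mapping.keys (f m))" by (rule keys_sum)
      also have "\<dots> \<subseteq> V" using f that by (force simp: exponents_def)
      finally show ?thesis by (simp add: exponents_def)
    qed
    let ?N = "sum f (Poly_Mapping.keys g)"
    have "?N + m \<in> E" if m: "m \<in> Poly_Mapping.keys g" for m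
    proof -
      \<comment> \<open>The summand \<open>f m\<close> already moves \<open>m\<close> into
        \<open>E\<close>; the remaining summands keep it there because \<open>E\<close> is an
        upset.\<close>
      have "?N + m = (f m + m) + sum f (Poly_Mapping.keys g - {m})"
        using sum.remove[OF _ m, of f] by (simp add: ac_simps)
      also have "\<dots> \<in> E" using f[OF m] sumV[of "Poly_Mapping.keys g - {m}"] E
        by (simp add: upset_def)
      finally show ?thesis .
    qed
    then have "mon ?N \<in> P" using sumV[of "Poly_Mapping.keys g"] by (simp add: mon_P)
    then have "Poly_Mapping.keys ?N \<inter> A \<noteq> {}" using meet sumV[of "Poly_Mapping.keys g"] by simp
    moreover have "Poly_Mapping.keys ?N \<subseteq> (\<Union>m\<in>Poly_Mapping.keys g. Poly_Mapping.keys (f m))"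
      by (rule keys_sum)
    ultimately show False using f by blast
  qed
  then obtain m where m: "m \<in> Poly_Mapping.keys g"
    "\<And>n. n \<in> exponents V \<Longrightarrow> n + m \<in> E \<Longrightarrow> Poly_Mapping.keys n \<inter> A \<noteq> {}" by blast
  have "n + m \<in> E \<longleftrightarrow> Poly_Mapping.keys n \<inter> A \<noteq> {}" if "n \<in> exponents V" for n
    using m meet[OF that] mon_P[of n] that by blast
  moreover have "m \<in> exponents V" using m g by (auto simp: monomial_ideal_def)
  ultimately have "assoc_vars V E A" by (auto simp: assoc_vars_def)
  with meet show ?thesis by (rule that[rotated])
qed

text \<open>Multipliers can be taken to be monomials: a polynomial outside the prime has a term
  avoiding \<open>A\<close>, and since the power is a monomial ideal that term alone already
  multiplies \<open>mon a\<close> into it. Hence only the monomials in each associated prime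
  matter.\<close>

lemma mon_in_symbolic_power:
  assumes V: "finite V" and E: "upset V E"
  shows "(mon a :: _ \<Rightarrow>\<^sub>0 'k::field) \<in> symbolic_power (mpoly_ring V) (monomial_ideal E) s \<longleftrightarrow>
    a \<in> exponents V \<and> (\<forall>A. assoc_vars V E A \<longrightarrow>
      (\<exists>u\<in>exponents V. Poly_Mapping.keys u \<inter> A = {} \<and> u + a \<in> sumset_power V E s))"
    (is "?L \<longleftrightarrow> ?R")
proof -
  let ?R\<^sub>k = "mpoly_ring V :: (_ \<Rightarrow>\<^sub>0 'k) ring" and ?I = "monomial_ideal E :: (_ \<Rightarrow>\<^sub>0 'k) set"
  interpret cring ?R\<^sub>k by (rule cring_mpoly_ring)
  have sym: "?L \<longleftrightarrow> a \<in> exponents V \<and> (\<forall>P\<in>associated_primes ?R\<^sub>k ?I.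
      \<exists>u\<in>monomial_ideal (exponents V) - P. u * mon a \<in> monomial_ideal (sumset_power V E s))"
    unfolding symbolic_power_iff[OF ideal_monomial_ideal[OF E]] ideal_power_monomial_ideal[OF E]
      mpoly_ring_simps mon_in_monomial_ideal ..
  show ?thesis
  proof
    assume L: ?L
    show ?R
    proof (intro conjI allI impI)
      show "a \<in> exponents V" using L sym by blast
      fix A assume "assoc_vars V E A"
      then obtain u :: "_ \<Rightarrow>\<^sub>0 'k" where u: "u \<in> monomial_ideal (exponents V)"
        "u \<notin> monomial_ideal (meeting V A)" "u * mon a \<in> monomial_ideal (sumset_power V E s)"
        using L meeting_in_associated_primes[OF V E] unfolding sym by blast
      then obtain n where "n \<in> Poly_Mapping.keys u" "n \<notin> meeting V A"
        by (auto simp: monomial_ideal_def)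
      then show "\<exists>u\<in>exponents V. Poly_Mapping.keys u \<inter> A = {} \<and> u + a \<in> sumset_power V E s"
        using u(1,3) unfolding mult_mon_in_monomial_ideal
        by (auto simp: monomial_ideal_def meeting_def)
    qed
  next
    assume R: ?R
    show ?L unfolding sym
    proof (intro conjI ballI)
      show "a \<in> exponents V" using R by blast
      fix P assume P: "P \<in> associated_primes ?R\<^sub>k ?I"
      obtain A where A: "assoc_vars V E A"
        "\<And>n. n \<in> exponents V \<Longrightarrow> mon n \<in> P \<longleftrightarrow> Poly_Mapping.keys n \<inter> A \<noteq> {}"
        using associated_primes_monomials[OF V E P] by blast
      then obtain u where u: "u \<in> exponents V" "Poly_Mapping.keys u \<inter> A = {}"
        "u + a \<in> sumset_power V E s"
        using R by blast
      then show "\<exists>u\<in>monomial_ideal (exponents V) - P.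
          u * mon a \<in> monomial_ideal (sumset_power V E s)"
        using A(2)[of u] by (intro bexI[of _ "mon u"]) (auto simp: mon_mult)
    qed
  qed
qed

section \<open>Rescaling exponents\<close>

lemma exponent_le_add:
  fixes a b :: "'v \<Rightarrow>\<^sub>0 nat"
  assumes "\<And>x. Poly_Mapping.lookup a x \<le> Poly_Mapping.lookup b x"
  shows "b = a + (b - a)"
  using assms by (intro poly_mapping_eqI) (simp add: lookup_add lookup_minus)

definition scale :: "('v \<Rightarrow> nat) \<Rightarrow> ('v \<Rightarrow>\<^sub>0 nat) \<Rightarrow> ('v \<Rightarrow>\<^sub>0 nat)" where
  "scale v a = Poly_Mapping.mapp (\<lambda>x n. v x * n) a"

text \<open>For positive \<open>v\<close>, floor division is adjoint to \<open>scale\<close>: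
  \<open>scale v b\<close> divides \<open>a\<close> exactly when \<open>b\<close> divides
  \<open>unscale v a\<close>.\<close>

definition unscale :: "('v \<Rightarrow> nat) \<Rightarrow> ('v \<Rightarrow>\<^sub>0 nat) \<Rightarrow> ('v \<Rightarrow>\<^sub>0 nat)" where
  "unscale v a = Poly_Mapping.mapp (\<lambda>x n. n div v x) a"

text \<open>For an upset \<open>E\<close> and positive \<open>v\<close> these are the exponents of
  the ideal generated by the image of \<open>monomial_ideal E\<close> under the substitution of the
  power \<open>v x\<close> of \<open>x\<close> for each variable \<open>x\<close>.\<close>

definition pullback :: "'v set \<Rightarrow> ('v \<Rightarrow> nat) \<Rightarrow> ('v \<Rightarrow>\<^sub>0 nat) set \<Rightarrow> ('v \<Rightarrow>\<^sub>0 nat) set" where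
  "pullback V v E = {a \<in> exponents V. unscale v a \<in> E}"

definition minimal_exponents :: "'v set \<Rightarrow> ('v \<Rightarrow>\<^sub>0 nat) set \<Rightarrow> ('v \<Rightarrow>\<^sub>0 nat) set" where
  "minimal_exponents V S = {a \<in> S. \<forall>b\<in>S. \<forall>c\<in>exponents V. a = b + c \<longrightarrow> b = a}"

lemma lookup_scale [simp]: "Poly_Mapping.lookup (scale v a) x = v x * Poly_Mapping.lookup a x"
  by (simp add: scale_def lookup_mapp when_def in_keys_iff)

lemma lookup_unscale [simp]: "Poly_Mapping.lookup (unscale v a) x = Poly_Mapping.lookup a x div v x"
  by (simp add: unscale_def lookup_mapp when_def in_keys_iff)

lemma scale_in_exponents [simp]: "a \<in> exponents V \<Longrightarrow> scale v a \<in> exponents V"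
  using keys_mapp_subset[of "\<lambda>x n. v x * n" a] by (auto simp: exponents_def scale_def)

lemma unscale_in_exponents [simp]: "a \<in> exponents V \<Longrightarrow> unscale v a \<in> exponents V"
  using keys_mapp_subset[of "\<lambda>x n. n div v x" a] by (auto simp: exponents_def unscale_def)

lemma scale_single:
  "scale v (Poly_Mapping.single x n) = Poly_Mapping.single x (v x * n)"
  by (rule poly_mapping_eqI) (simp add: lookup_single when_def)

lemma scale_add: "scale v (a + b) = scale v a + scale v b"
  by (rule poly_mapping_eqI) (simp add: lookup_add algebra_simps)

lemma diff_in_exponents: "b = a + (b - a) \<Longrightarrow> b \<in> exponents V \<Longrightarrow> b - a \<in> exponents V"
  by (metis add_in_exponents)

lemma pullback_exponents: "pullback V v (exponents V) = exponents V"
  by (auto simp: pullback_def)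

section \<open>Transfer of sums, associated primes and minimal generators along the
  rescaling\<close>

context
  fixes V :: "'v set" and v :: "'v \<Rightarrow> nat"
  assumes finite_V: "finite V" and v_pos: "\<And>x. v x > 0"
begin

lemma v_nonzero [simp]: "v x \<noteq> 0"
  using v_pos[of x] by simp

lemma unscale_scale_add: "unscale v (scale v a + b) = a + unscale v b"
  by (rule poly_mapping_eqI) (simp add: lookup_add)

lemma unscale_scale [simp]: "unscale v (scale v a) = a"
  by (rule poly_mapping_eqI) simp

lemma scale_unscale_split: "a = scale v (unscale v a) + (a - scale v (unscale v a))"
  by (rule exponent_le_add) simp

text \<open>Floor division is superadditive: two remainders may produce a carry, which only enlarges
  the quotient of the sum. An upset absorbs this surplus.\<close>

lemma unscale_add_split:
  "unscale v (a + b) = (unscale v a + unscale v b) + (unscale v (a + b) - (unscale v a + unscale v b))"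
proof (rule exponent_le_add)
  show "Poly_Mapping.lookup (unscale v a + unscale v b) x \<le> Poly_Mapping.lookup (unscale v (a + b)) x" for x
    using div_add1_eq[of "Poly_Mapping.lookup a x" "Poly_Mapping.lookup b x" "v x"]
    by (simp add: lookup_add)
qed

lemma unscale_add_in:
  assumes "upset V E" "a \<in> exponents V" "b \<in> exponents V" "unscale v a + unscale v b \<in> E"
  shows "unscale v (a + b) \<in> E"
proof -
  have "unscale v (a + b) - (unscale v a + unscale v b) \<in> exponents V"
    using assms by (intro diff_in_exponents[OF unscale_add_split]) simp
  then show ?thesis using assms unscale_add_split[of a b] by (metis upset_def)
qed

lemma upset_pullback: "upset V E \<Longrightarrow> upset V (pullback V v E)"
  using unscale_add_in[of E] by (simp add: upset_def pullback_def subset_iff)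

lemma sumset_scale_image:
  assumes "B \<subseteq> exponents V"
  shows "sumset (scale v ` B) (exponents V) = pullback V v (sumset B (exponents V))"
proof (intro Set.set_eqI iffI)
  fix a assume "a \<in> sumset (scale v ` B) (exponents V)"
  then obtain b c where "b \<in> B" "c \<in> exponents V" "a = scale v b + c"
    by (auto simp: sumset_def)
  moreover from this have "b + unscale v c \<in> sumset B (exponents V)"
    unfolding sumset_def using unscale_in_exponents by blast
  ultimately show "a \<in> pullback V v (sumset B (exponents V))"
    using assms by (auto simp: pullback_def unscale_scale_add)
next
  fix a assume "a \<in> pullback V v (sumset B (exponents V))"
  then obtain b c where bc: "a \<in> exponents V" "unscale v a = b + c" "b \<in> B" "c \<in> exponents V"
    by (auto simp: sumset_def pullback_def)
  note scale_unscale_split[of a]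
  also have "scale v (unscale v a) + (a - scale v (unscale v a))
      = scale v b + (scale v c + (a - scale v (unscale v a)))"
    by (simp add: bc(2) scale_add add.assoc)
  finally have a: "a = scale v b + (scale v c + (a - scale v (unscale v a)))" .
  have "a - scale v (unscale v a) \<in> exponents V"
    using bc by (intro diff_in_exponents[OF scale_unscale_split])
  then have "scale v c + (a - scale v (unscale v a)) \<in> exponents V"
    using bc by simp
  then show "a \<in> sumset (scale v ` B) (exponents V)"
    unfolding sumset_def using a bc(3) by blast
qed

text \<open>From left to right, superadditivity suffices. From right to left, the first summand is
  taken to be an exact multiple and the whole remainder goes to the second, so no carry is
  lost.\<close>

lemma sumset_pullback:
  assumes E: "upset V E" and F: "upset V F"
  shows "sumset (pullback V v E) (pullback V v F) = pullback V v (sumset E F)"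
proof (intro Set.set_eqI iffI)
  fix a assume "a \<in> sumset (pullback V v E) (pullback V v F)"
  then obtain b c where "a = b + c" "b \<in> exponents V" "c \<in> exponents V"
    "unscale v b \<in> E" "unscale v c \<in> F"
    by (auto simp: sumset_def pullback_def)
  moreover from this have "unscale v b + unscale v c \<in> sumset E F" by (auto simp: sumset_def)
  ultimately show "a \<in> pullback V v (sumset E F)"
    using unscale_add_in[OF upset_sumset[OF E F]] by (simp add: pullback_def)
next
  fix a assume "a \<in> pullback V v (sumset E F)"
  then obtain b c where bc: "a \<in> exponents V" "unscale v a = b + c" "b \<in> E" "c \<in> F"
    by (auto simp: sumset_def pullback_def)
  define d where "d = scale v c + (a - scale v (unscale v a))"
  note scale_unscale_split[of a]
  also have "scale v (unscale v a) + (a - scale v (unscale v a)) = scale v b + d"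
    by (simp add: d_def bc(2) scale_add add.assoc)
  finally have a: "a = scale v b + d" .
  \<comment> \<open>An exact multiple passes through the division unchanged, so cancelling
    \<open>b\<close> identifies the quotient of \<open>d\<close>.\<close>
  have "b + unscale v d = b + c"
    using bc(2) a unscale_scale_add[of b d] by simp
  then have "unscale v d = c" by simp
  moreover have "d \<in> exponents V" using a bc(1) by (metis add_in_exponents)
  moreover have "b \<in> exponents V" using E bc by (auto simp: upset_def)
  ultimately show "a \<in> sumset (pullback V v E) (pullback V v F)"
    unfolding sumset_def pullback_def using a bc by force
qed

lemma sumset_power_pullback:
  "upset V E \<Longrightarrow> sumset_power V (pullback V v E) s = pullback V v (sumset_power V E s)"
  by (induction s) (simp_all add: pullback_exponents sumset_pullback upset_sumset_power)

lemma keys_scale: "Poly_Mapping.keys (scale v n) = Poly_Mapping.keys n"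
  by (auto simp: in_keys_iff)

text \<open>A witness \<open>m\<close> for \<open>E\<close> becomes a witness for the pullback after raising every coordinate to the
  top of its residue block, so that adding any variable of \<open>A\<close> crosses to the next block.\<close>

lemma assoc_vars_pullback:
  assumes E: "upset V E"
  shows "assoc_vars V (pullback V v E) A \<longleftrightarrow> assoc_vars V E A"
proof
  assume "assoc_vars V (pullback V v E) A"
  then obtain m where m: "m \<in> exponents V"
    "\<And>n. n \<in> exponents V \<Longrightarrow> n + m \<in> pullback V v E \<longleftrightarrow> Poly_Mapping.keys n \<inter> A \<noteq> {}"
    by (auto simp: assoc_vars_def)
  \<comment> \<open>Testing \<open>m\<close> against \<open>scale v n\<close> suffices: scaling by
    positive factors preserves the support and commutes with the division.\<close>
  have "n + unscale v m \<in> E \<longleftrightarrow> Poly_Mapping.keys n \<inter> A \<noteq> {}" if "n \<in> exponents V" for n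
    using m(1) m(2)[of "scale v n"] that
    by (simp add: pullback_def unscale_scale_add keys_scale)
  then show "assoc_vars V E A"
    unfolding assoc_vars_def using unscale_in_exponents[OF m(1)] by blast
next
  assume "assoc_vars V E A"
  then obtain m where m: "m \<in> exponents V"
    "\<And>n. n \<in> exponents V \<Longrightarrow> n + m \<in> E \<longleftrightarrow> Poly_Mapping.keys n \<inter> A \<noteq> {}"
    by (auto simp: assoc_vars_def)
  \<comment> \<open>The largest remainder in each coordinate of \<open>V\<close>; it is
    \<open>0\<close> where \<open>v x = 1\<close>.\<close>
  define t where "t = (\<Sum>x\<in>V. Poly_Mapping.single x (v x - 1))"
  have t: "Poly_Mapping.lookup t x = (if x \<in> V then v x - 1 else 0)" for x
    using finite_V by (simp add: t_def lookup_sum lookup_single when_def sum.delta)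
  have tV: "t \<in> exponents V" by (auto simp: exponents_def in_keys_iff t split: if_splits)
  have "n + (scale v m + t) \<in> pullback V v E \<longleftrightarrow> Poly_Mapping.keys n \<inter> A \<noteq> {}"
    if n: "n \<in> exponents V" for n
  proof -
    have keys: "Poly_Mapping.keys (unscale v (n + t)) = Poly_Mapping.keys n"
    proof -
      \<comment> \<open>With \<open>t\<close> added, the quotient at a variable of \<open>V\<close>
        is the rounded-up one, which is nonzero exactly when \<open>n\<close> is nonzero
        there.\<close>
      have "(Poly_Mapping.lookup n x + Poly_Mapping.lookup t x) div v x \<noteq> 0
          \<longleftrightarrow> Poly_Mapping.lookup n x \<noteq> 0" for x
        using v_pos[of x] lookup_eq_0[OF n, of x] by (auto simp: t div_eq_0_iff)
      then show ?thesis by (auto simp: in_keys_iff lookup_add)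
    qed
    have "unscale v (n + (scale v m + t)) = unscale v (n + t) + m"
      using unscale_scale_add[of m "n + t"] by (simp add: ac_simps)
    then show ?thesis
      using m(1) m(2)[of "unscale v (n + t)"] n tV keys by (simp add: pullback_def)
  qed
  then show "assoc_vars V (pullback V v E) A"
    using m(1) tV by (auto simp: assoc_vars_def intro!: bexI[of _ "scale v m + t"])
qed

text \<open>Forwards, the increase of the quotients caused by \<open>u\<close> is supported where
  \<open>u\<close> is, so it still avoids \<open>A\<close>. Backwards, \<open>scale v u\<close> has
  the support of \<open>u\<close>.\<close>

lemma exists_disjoint_translate_pullback:
  assumes a: "a \<in> exponents V"
  shows "(\<exists>u\<in>exponents V. Poly_Mapping.keys u \<inter> A = {} \<and> u + a \<in> pullback V v F) \<longleftrightarrow>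
    (\<exists>u\<in>exponents V. Poly_Mapping.keys u \<inter> A = {} \<and> u + unscale v a \<in> F)"
proof
  assume "\<exists>u\<in>exponents V. Poly_Mapping.keys u \<inter> A = {} \<and> u + a \<in> pullback V v F"
  then obtain u where u: "u \<in> exponents V" "Poly_Mapping.keys u \<inter> A = {}" "unscale v (u + a) \<in> F"
    by (auto simp: pullback_def)
  define u' where "u' = unscale v (u + a) - unscale v a"
  have eq: "unscale v (u + a) = unscale v a + u'"
    unfolding u'_def by (rule exponent_le_add) (simp add: lookup_add div_le_mono)
  have "Poly_Mapping.keys u' \<subseteq> Poly_Mapping.keys u"
  proof
    fix x assume "x \<in> Poly_Mapping.keys u'"
    then have "\<not> (Poly_Mapping.lookup u x + Poly_Mapping.lookup a x) div v x
        \<le> Poly_Mapping.lookup a x div v x"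
      by (simp add: u'_def in_keys_iff lookup_minus lookup_add)
    then show "x \<in> Poly_Mapping.keys u"
      by (metis add_0 in_keys_iff order_refl)
  qed
  then show "\<exists>u\<in>exponents V. Poly_Mapping.keys u \<inter> A = {} \<and> u + unscale v a \<in> F"
    using u eq by (intro bexI[of _ u']) (auto simp: add.commute exponents_def)
next
  assume "\<exists>u\<in>exponents V. Poly_Mapping.keys u \<inter> A = {} \<and> u + unscale v a \<in> F"
  then obtain u where "u \<in> exponents V" "Poly_Mapping.keys u \<inter> A = {}" "u + unscale v a \<in> F"
    by blast
  then show "\<exists>u\<in>exponents V. Poly_Mapping.keys u \<inter> A = {} \<and> u + a \<in> pullback V v F"
    using a by (intro bexI[of _ "scale v u"]) (simp_all add: pullback_def unscale_scale_add keys_scale)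
qed

lemma mon_in_symbolic_power_pullback:
  assumes E: "upset V E" and a: "a \<in> exponents V"
  shows "(mon a :: _ \<Rightarrow>\<^sub>0 'k::field)
      \<in> symbolic_power (mpoly_ring V) (monomial_ideal (pullback V v E)) s \<longleftrightarrow>
    (mon (unscale v a) :: _ \<Rightarrow>\<^sub>0 'k) \<in> symbolic_power (mpoly_ring V) (monomial_ideal E) s"
  unfolding mon_in_symbolic_power[OF finite_V E]
    mon_in_symbolic_power[OF finite_V upset_pullback[OF E]]
    assoc_vars_pullback[OF E] sumset_power_pullback[OF E]
    exists_disjoint_translate_pullback[OF a]
  using a by simp

text \<open>The pullback condition sees only quotients, so a minimal exponent has no remainders and
  lies in the image of \<open>scale v\<close>. On that image divisibility agrees before and after
  scaling.\<close>

lemma minimal_exponents_pullback: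
  assumes S: "S \<subseteq> exponents V"
  shows "minimal_exponents V (pullback V v S) - pullback V v T
    = scale v ` (minimal_exponents V S - T)"
proof (intro Set.set_eqI iffI)
  fix a assume a: "a \<in> minimal_exponents V (pullback V v S) - pullback V v T"
  then have aV: "a \<in> exponents V" "unscale v a \<in> S" "unscale v a \<notin> T"
    by (auto simp: minimal_exponents_def pullback_def)
  have min: "b = a" if "b \<in> pullback V v S" "c \<in> exponents V" "a = b + c" for b c
    using a that by (auto simp: minimal_exponents_def)
  have "scale v (unscale v a) \<in> pullback V v S" using aV by (simp add: pullback_def)
  then have eq: "scale v (unscale v a) = a"
    using diff_in_exponents[OF scale_unscale_split aV(1)] scale_unscale_split by (rule min)
  have "b = unscale v a" if b: "b \<in> S" "c \<in> exponents V" "unscale v a = b + c" for b c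
  proof -
    have "a = scale v b + scale v c" using eq b(3) by (metis scale_add)
    moreover have "scale v b \<in> pullback V v S" "scale v c \<in> exponents V"
      using b S by (auto simp: pullback_def)
    ultimately have "scale v b = a" using min by blast
    then show ?thesis by auto
  qed
  then have "unscale v a \<in> minimal_exponents V S - T"
    using aV by (auto simp: minimal_exponents_def)
  then show "a \<in> scale v ` (minimal_exponents V S - T)" using eq by (metis imageI)
next
  fix a' assume "a' \<in> scale v ` (minimal_exponents V S - T)"
  then obtain a where a': "a' = scale v a" and a: "a \<in> S" "a \<notin> T"
    and min: "\<And>b c. b \<in> S \<Longrightarrow> c \<in> exponents V \<Longrightarrow> a = b + c \<Longrightarrow> b = a"
    by (auto simp: minimal_exponents_def)
  have "b = scale v a" if b: "b \<in> pullback V v S" "c \<in> exponents V" "scale v a = b + c" for b c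
  proof -
    have bV: "b \<in> exponents V" "unscale v b \<in> S" using b by (auto simp: pullback_def)
    have eq: "a = unscale v b + (a - unscale v b)"
    proof (rule exponent_le_add)
      fix x
      have "Poly_Mapping.lookup b x \<le> v x * Poly_Mapping.lookup a x"
        by (metis b(3) le_add1 lookup_add lookup_scale)
      then show "Poly_Mapping.lookup (unscale v b) x \<le> Poly_Mapping.lookup a x"
        using v_pos[of x] by (simp add: div_le_mono[THEN order_trans])
    qed
    \<comment> \<open>Minimality of \<open>a\<close> gives equal quotients. Then
      \<open>scale v a\<close> divides \<open>b\<close>, while \<open>b\<close> divides
      \<open>scale v a\<close>, which leaves no room for \<open>c\<close>.\<close>
    then have "unscale v b = a"
      using min[OF bV(2) _ eq] diff_in_exponents[OF eq] a S by blast
    then have "b = scale v a + (b - scale v a)" using scale_unscale_split[of b] by metis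
    then have "scale v a + 0 = scale v a + ((b - scale v a) + c)" using b(3)
      by (metis add.assoc add.right_neutral)
    then have "b - scale v a + c = 0" by (metis add_left_cancel)
    then have "c = 0" by (metis Un_empty keys_add_nat keys_eq_empty)
    then show ?thesis using b(3) by simp
  qed
  then show "a' \<in> minimal_exponents V (pullback V v S) - pullback V v T"
    using a S unfolding a' by (auto simp: minimal_exponents_def pullback_def)
qed

end

section \<open>Minimal generators and the symbolic defect in terms of exponents\<close>

lemma mon_divides_mon:
  "(mon a :: _ \<Rightarrow>\<^sub>0 'k::field) divides\<^bsub>mpoly_ring V\<^esub> mon b \<longleftrightarrow> (\<exists>c\<in>exponents V. b = a + c)"
proof
  assume "(mon a :: _ \<Rightarrow>\<^sub>0 'k) divides\<^bsub>mpoly_ring V\<^esub> mon b"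
  then obtain p :: "_ \<Rightarrow>\<^sub>0 'k" where p: "p \<in> monomial_ideal (exponents V)" "mon b = p * mon a"
    by (auto simp: factor_def mult.commute)
  \<comment> \<open>The cofactor is an arbitrary polynomial; comparing terms shows that one of its
    exponents is the required difference.\<close>
  then have "Poly_Mapping.keys (mon b :: _ \<Rightarrow>\<^sub>0 'k) = (\<lambda>n. n + a) ` Poly_Mapping.keys p"
    by (simp only: keys_mult_mon)
  then have "b \<in> (\<lambda>n. n + a) ` Poly_Mapping.keys p" by (metis keys_single singletonI zero_neq_one)
  then show "\<exists>c\<in>exponents V. b = a + c"
    using p(1) by (auto simp: monomial_ideal_def add.commute)
next
  assume "\<exists>c\<in>exponents V. b = a + c"
  then obtain c where "c \<in> exponents V" "b = a + c" by blast
  then show "(mon a :: _ \<Rightarrow>\<^sub>0 'k) divides\<^bsub>mpoly_ring V\<^esub> mon b"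
    unfolding factor_def by (intro bexI[of _ "mon c"]) (simp_all add: mon_mult)
qed

lemma mon_eq_iff [simp]: "(mon a :: _ \<Rightarrow>\<^sub>0 'k::field) = mon b \<longleftrightarrow> a = b"
  by (metis keys_single singleton_inject zero_neq_one)

lemma min_mon_gens_eq:
  fixes J :: "(('v \<Rightarrow>\<^sub>0 nat) \<Rightarrow>\<^sub>0 'k::field) set"
  shows "min_mon_gens V J = mon ` minimal_exponents V {a \<in> exponents V. mon a \<in> J}"
proof -
  have mons: "monomials V = (mon ` exponents V :: (_ \<Rightarrow>\<^sub>0 'k) set)"
    by (auto simp: monomials_def exponents_def)
  have "mon a \<in> min_mon_gens V J \<longleftrightarrow> a \<in> minimal_exponents V {a \<in> exponents V. mon a \<in> J}" for a
  proof -
    have "mon a \<in> min_mon_gens V J \<longleftrightarrow> a \<in> exponents V \<and> mon a \<in> J \<and>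
        (\<forall>b\<in>exponents V. mon b \<in> J \<longrightarrow>
          (mon b :: _ \<Rightarrow>\<^sub>0 'k) divides\<^bsub>mpoly_ring V\<^esub> mon a \<longrightarrow> b = a)"
      unfolding min_mon_gens_def mons by auto
    then show ?thesis unfolding mon_divides_mon minimal_exponents_def by blast
  qed
  moreover have "min_mon_gens V J \<subseteq> range mon"
    by (auto simp: min_mon_gens_def mons)
  ultimately show ?thesis by blast
qed

lemma sdefect_eq_card_exponents:
  "sdefect V I s = card (minimal_exponents V {a \<in> exponents V. mon a \<in> symbolic_power (mpoly_ring V) I s}
     - {a \<in> exponents V. mon a \<in> ideal_power (mpoly_ring V) I s})" (is "_ = card ?M")
proof -
  have "min_mon_gens V (symbolic_power (mpoly_ring V) I s) - ideal_power (mpoly_ring V) I s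
      = mon ` ?M"
    unfolding min_mon_gens_eq by (auto simp: minimal_exponents_def)
  then show ?thesis by (simp add: sdefect_def card_image inj_on_def)
qed

text \<open>Both exponent sets in the defect formula are pullbacks, so the counted minimal exponents
  correspond under \<open>scale v\<close>, which is injective with left inverse
  \<open>unscale v\<close>.\<close>

lemma sdefect_pullback:
  assumes V: "finite V" and v: "\<And>x. v x > 0" and E: "upset V E"
  shows "sdefect V (monomial_ideal (pullback V v E) :: (_ \<Rightarrow>\<^sub>0 'k::field) set) s
    = sdefect V (monomial_ideal E :: (_ \<Rightarrow>\<^sub>0 'k) set) s"
proof -
  let ?S = "{a \<in> exponents V. (mon a :: _ \<Rightarrow>\<^sub>0 'k)
    \<in> symbolic_power (mpoly_ring V) (monomial_ideal E) s}"
  let ?T = "sumset_power V E s"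
  have pow: "{a \<in> exponents V. (mon a :: _ \<Rightarrow>\<^sub>0 'k)
      \<in> ideal_power (mpoly_ring V) (monomial_ideal F) s} = sumset_power V F s"
    if "upset V F" for F
    using upset_sumset_power[OF that, of s] unfolding ideal_power_monomial_ideal[OF that]
    by (auto simp: upset_def)
  have sym: "{a \<in> exponents V. (mon a :: _ \<Rightarrow>\<^sub>0 'k)
      \<in> symbolic_power (mpoly_ring V) (monomial_ideal (pullback V v E)) s} = pullback V v ?S"
    using mon_in_symbolic_power_pullback[where v = v, OF V v E] by (auto simp: pullback_def[of V v ?S])
  have "minimal_exponents V (pullback V v ?S) - pullback V v ?T
      = scale v ` (minimal_exponents V ?S - ?T)"
    by (rule minimal_exponents_pullback[where v = v, OF V v]) auto
  moreover have "inj (scale v)" by (metis injI unscale_scale[where v = v, OF V v])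
  ultimately show ?thesis
    unfolding sdefect_eq_card_exponents sym pow[OF E] pow[OF upset_pullback[where v = v, OF V v E]]
      sumset_power_pullback[where v = v, OF V v E]
    by (simp add: card_image inj_on_subset)
qed

section \<open>Edge ideals\<close>

definition edge_exponents :: "'v pair_pre_digraph \<Rightarrow> ('v \<Rightarrow> nat) \<Rightarrow> ('v \<Rightarrow>\<^sub>0 nat) set" where
  "edge_exponents G w = (\<lambda>(x, y). Poly_Mapping.single x 1 + Poly_Mapping.single y (w y)) ` parcs G"

lemma (in pair_digraph) edge_exponents_subset: "edge_exponents G w \<subseteq> exponents (pverts G)"
  by (auto simp: edge_exponents_def exponents_def keys_add_nat dest: in_arcsD1 in_arcsD2 split: if_splits)

lemma (in pair_digraph) edge_ideal_eq:
  "edge_ideal G w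
    = (monomial_ideal (sumset (edge_exponents G w) (exponents (pverts G))) :: (_ \<Rightarrow>\<^sub>0 'k::field) set)"
proof -
  have "mvar y ^ n = (mon (Poly_Mapping.single y n) :: _ \<Rightarrow>\<^sub>0 'k)" for y :: 'a and n
    by (induction n) (simp_all add: mvar_def mon_mult single_add[symmetric])
  then have "{mvar x * mvar y ^ w y | x y. (x, y) \<in> parcs G}
      = (mon ` edge_exponents G w :: (_ \<Rightarrow>\<^sub>0 'k) set)"
    unfolding edge_exponents_def by (force simp: mvar_def mon_mult)
  then show ?thesis
    unfolding edge_ideal_def using genideal_monomials[OF edge_exponents_subset] by simp
qed

theorem proposition4p5:
  fixes G :: "'v pair_pre_digraph" and w w' :: "'v \<Rightarrow> nat" and U :: "'v set"
    and I I' :: "(('v \<Rightarrow>\<^sub>0 nat) \<Rightarrow>\<^sub>0 'k::field) set" and s :: nat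
  assumes "weighted_oriented_graph G w"
    and "U = {x \<in> nontrivial_verts G w. sink G x}"
    and "w' = (\<lambda>x. if x \<in> U then 1 else w x)"
    and "I = edge_ideal G w" and "I' = edge_ideal G w'"
    and "s \<ge> 1"
  shows "sdefect (pverts G) I' s = sdefect (pverts G) I s"
proof -
  interpret weighted_oriented_graph G w by (rule assms(1))
  let ?V = "pverts G"
  \<comment> \<open>Rescaling must restore the weights that were reset:
    \<open>v y * w' y = w y\<close> for every \<open>y\<close>. Off \<open>U\<close> the factor is
    1, which also makes \<open>v\<close> positive outside the vertex set.\<close>
  define v where "v = (\<lambda>x. if x \<in> U then w x else 1)"
  have v: "v x > 0" for x
    using weight_pos[of x] by (auto simp: v_def assms(2) nontrivial_verts_def)
  have V: "finite ?V" by simp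
  let ?B = "edge_exponents G w'"
  let ?E = "sumset ?B (exponents ?V)"
  have B: "?B \<subseteq> exponents ?V" by (rule edge_exponents_subset)
  have E: "upset ?V ?E" by (rule upset_sumset_exponents[OF B])
  have "scale v (Poly_Mapping.single x 1 + Poly_Mapping.single y (w' y))
      = Poly_Mapping.single x 1 + Poly_Mapping.single y (w y)" if "(x, y) \<in> parcs G" for x y
  proof -
    \<comment> \<open>The tail of an edge is not a sink, so its exponent 1 is not rescaled; only
      heads can change.\<close>
    have "x \<notin> U" using that by (auto simp: assms(2) sink_def)
    then show ?thesis by (simp add: scale_add scale_single v_def assms(3))
  qed
  then have "edge_exponents G w = scale v ` ?B"
    unfolding edge_exponents_def image_image by (intro image_cong) auto
  then have "I = monomial_ideal (pullback ?V v ?E)"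
    using sumset_scale_image[where v = v, OF V v B] by (simp add: assms(4) edge_ideal_eq)
  moreover have "I' = monomial_ideal ?E" by (simp add: assms(5) edge_ideal_eq)
  ultimately show ?thesis using sdefect_pullback[where v = v and 'k = 'k, OF V v E] by simp
qed

end
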